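(* Let $X$ and $Y$ be Banach spaces such that $\Phi_-(X,Y)\neq\emptyset$, there exists a surjective bounded linear operator from $X$ onto $X\times X$, and every closed infinite codimensional subspace of $Y$ is contained in a closed infinite codimensional subspace $N$ of $Y$ which is isomorphic to a quotient of $X$. Then $P\Phi_-(X,Y)=\mathcal{SC}(X,Y)$.
   Context: $\mathcal{L}(X,Y)$ denotes the set of bounded linear operators from $X$ into $Y$. For Banach spaces, "isomorphic" means that there is a bijective bounded linear operator (with bounded inverse) between them; a quotient of $X$ is $X/M$ with $M$ a closed subspace of $X$. $X\times X$ is endowed with the norm $\|(x_1,x_2)\|_\infty=\max\{\|x_1\|,\|x_2\|\}$. $T\in\mathcal{L}(X,Y)$ is lower semi-Fredholm, $T\in\Phi_-(X,Y)$, if its range is finite codimensional in $Y$ (hence closed). $T$ is strictly cosingular, $T\in\mathcal{SC}(X,Y)$, if there is no infinite codimensional closed subspace $N$ of $Y$ such that $Q_NT$ is surjective, where $Q_N:Y\to Y/N$ is the quotient map. When $\Phi_-(X,Y)\neq\emptyset$, the perturbation class is $P\Phi_-(X,Y)=\{K\in\mathcal{L}(X,Y): T+K\in\Phi_-(X,Y)\text{ for each }T\in\Phi_-(X,Y)\}$. *)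

theory Defs
  imports "HOL-Analysis.Analysis"
begin

text \<open>
  Real and complex Banach spaces are treated at once: a Banach space over the scalar field \<open>'k\<close>
  is a type of class \<open>banach\<close> with a scalar multiplication by \<open>'k\<close> that extends the real one and
  for which the norm is homogeneous. Up to isomorphism, the only fields in the class
  \<open>real_normed_field\<close>, where the norm is multiplicative, are the real and the complex numbers.
\<close>

locale banach_over = vector_space scale
  for scale :: "'k::real_normed_field \<Rightarrow> 'a::banach \<Rightarrow> 'a" +
  assumes scale_of_real: "scale (of_real r) x = r *\<^sub>R x"
    and norm_scale: "norm (scale c x) = norm c * norm x"

lemma banach_over_scaleR: "banach_over (scaleR :: real \<Rightarrow> 'a::banach \<Rightarrow> 'a)"
  by unfold_locales (auto simp: algebra_simps)

lemma banach_over_complex: "banach_over ((*) :: complex \<Rightarrow> complex \<Rightarrow> complex)"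
  by unfold_locales (auto simp: algebra_simps norm_mult scaleR_conv_of_real)

definition closed_subspace :: "('k::real_normed_field \<Rightarrow> 'a::banach \<Rightarrow> 'a) \<Rightarrow> 'a set \<Rightarrow> bool" where
  "closed_subspace s M \<longleftrightarrow> module.subspace s M \<and> closed M"

definition bounded_ops ::
  "('k::real_normed_field \<Rightarrow> 'a::banach \<Rightarrow> 'a) \<Rightarrow> ('k \<Rightarrow> 'b::banach \<Rightarrow> 'b) \<Rightarrow> ('a \<Rightarrow> 'b) set" where
  "bounded_ops sX sY =
     {T. Vector_Spaces.linear sX sY T \<and> (\<exists>B. \<forall>x. norm (T x) \<le> B * norm x)}"


subsection \<open>Quotient spaces\<close>

text \<open>
  The elements of the quotient by \<open>M\<close> are the cosets of \<open>M\<close>. In \<open>quot_scale\<close> the summand from \<open>M\<close>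
  is needed only for the scalar 0, where the pointwise multiple of a coset is \<open>{0}\<close> and not \<open>M\<close>.
\<close>

definition quot_map :: "'a::ab_group_add set \<Rightarrow> 'a \<Rightarrow> 'a set" where
  "quot_map M x = {x + m |m. m \<in> M}"

definition quot :: "'a::ab_group_add set \<Rightarrow> 'a set set" where
  "quot M = range (quot_map M)"

definition quot_add :: "'a::ab_group_add set \<Rightarrow> 'a set \<Rightarrow> 'a set" where
  "quot_add C D = {x + y |x y. x \<in> C \<and> y \<in> D}"

definition quot_scale ::
  "('k \<Rightarrow> 'a::ab_group_add \<Rightarrow> 'a) \<Rightarrow> 'a set \<Rightarrow> 'k \<Rightarrow> 'a set \<Rightarrow> 'a set" where
  "quot_scale s M c C = {s c x + m |x m. x \<in> C \<and> m \<in> M}"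

definition quot_norm :: "'a::real_normed_vector set \<Rightarrow> real" where
  "quot_norm C = (INF x\<in>C. norm x)"

lemma quot_add_quot_map:
  assumes "module s" "module.subspace s M"
  shows "quot_add (quot_map M x) (quot_map M y) = quot_map M (x + y)"
proof -
  interpret module s by fact
  have "x + m + (y + n) \<in> quot_map M (x + y)" if "m \<in> M" "n \<in> M" for m n
    using subspace_add[OF assms(2) that] unfolding quot_map_def
    by (auto intro!: exI[of _ "m + n"] simp: algebra_simps)
  moreover have "\<exists>m' n'. x + y + m = x + m' + (y + n') \<and> m' \<in> M \<and> n' \<in> M" if "m \<in> M" for m
    using that subspace_0[OF assms(2)] by (intro exI[of _ m] exI[of _ 0]) auto
  ultimately show ?thesis
    unfolding quot_add_def quot_map_def by (auto; metis)
qed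

lemma quot_scale_quot_map:
  assumes "module s" "module.subspace s M"
  shows "quot_scale s M c (quot_map M x) = quot_map M (s c x)"
proof -
  interpret module s by fact
  have "s c (x + m) + n \<in> quot_map M (s c x)" if "m \<in> M" "n \<in> M" for m n
    using subspace_add[OF assms(2) subspace_scale[OF assms(2) that(1)] that(2)]
    unfolding quot_map_def
    by (auto intro!: exI[of _ "s c m + n"] simp: scale_right_distrib add.assoc)
  moreover have "\<exists>m' n'. s c x + m = s c (x + m') + n' \<and> m' \<in> M \<and> n' \<in> M" if "m \<in> M" for m
    using that subspace_0[OF assms(2)] by (intro exI[of _ 0] exI[of _ m]) auto
  ultimately show ?thesis
    unfolding quot_scale_def quot_map_def by (auto; metis)
qed

text \<open>
  The quotient by \<open>M\<close> is finite dimensional: the classes of finitely many vectors span it.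
  The subspace \<open>M\<close> need not be closed.
\<close>

definition finite_codim :: "('k::field \<Rightarrow> 'a::ab_group_add \<Rightarrow> 'a) \<Rightarrow> 'a set \<Rightarrow> bool" where
  "finite_codim s M \<longleftrightarrow> (\<exists>B. finite B \<and> quot_map M ` module.span s B = quot M)"

definition isomorphic_quot ::
  "('k::real_normed_field \<Rightarrow> 'a::banach \<Rightarrow> 'a) \<Rightarrow> ('k \<Rightarrow> 'b::banach \<Rightarrow> 'b) \<Rightarrow> 'a set \<Rightarrow> 'b set \<Rightarrow> bool"
where
  "isomorphic_quot sX sY M N \<longleftrightarrow>
     (\<exists>\<phi>. bij_betw \<phi> (quot M) N \<and>
          (\<forall>C\<in>quot M. \<forall>D\<in>quot M. \<phi> (quot_add C D) = \<phi> C + \<phi> D) \<and>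
          (\<forall>c. \<forall>C\<in>quot M. \<phi> (quot_scale sX M c C) = sY c (\<phi> C)) \<and>
          (\<exists>B. \<forall>C\<in>quot M. norm (\<phi> C) \<le> B * quot_norm C) \<and>
          (\<exists>B. \<forall>y\<in>N. quot_norm (inv_into (quot M) \<phi> y) \<le> B * norm y))"


subsection \<open>Classes of operators\<close>

definition lower_semi_Fredholm ::
  "('k::real_normed_field \<Rightarrow> 'a::banach \<Rightarrow> 'a) \<Rightarrow> ('k \<Rightarrow> 'b::banach \<Rightarrow> 'b) \<Rightarrow> ('a \<Rightarrow> 'b) set" where
  "lower_semi_Fredholm sX sY = {T \<in> bounded_ops sX sY. finite_codim sY (range T)}"

definition strictly_cosingular ::
  "('k::real_normed_field \<Rightarrow> 'a::banach \<Rightarrow> 'a) \<Rightarrow> ('k \<Rightarrow> 'b::banach \<Rightarrow> 'b) \<Rightarrow> ('a \<Rightarrow> 'b) set" where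
  "strictly_cosingular sX sY =
     {T \<in> bounded_ops sX sY.
        \<not> (\<exists>N. closed_subspace sY N \<and> \<not> finite_codim sY N \<and> range (quot_map N \<circ> T) = quot N)}"

definition perturbation_class_lower ::
  "('k::real_normed_field \<Rightarrow> 'a::banach \<Rightarrow> 'a) \<Rightarrow> ('k \<Rightarrow> 'b::banach \<Rightarrow> 'b) \<Rightarrow> ('a \<Rightarrow> 'b) set" where
  "perturbation_class_lower sX sY =
     {K \<in> bounded_ops sX sY.
        \<forall>T\<in>lower_semi_Fredholm sX sY. (\<lambda>x. T x + K x) \<in> lower_semi_Fredholm sX sY}"

text \<open>
  Boundedness of operators into the product refers to the maximum norm; the library's norm on the
  type of pairs is the Euclidean one.
\<close>

definition bounded_ops_square ::
  "('k::real_normed_field \<Rightarrow> 'a::banach \<Rightarrow> 'a) \<Rightarrow> ('a \<Rightarrow> 'a \<times> 'a) set" where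
  "bounded_ops_square s =
     {U. Vector_Spaces.linear s (\<lambda>c. map_prod (s c) (s c)) U \<and>
         (\<exists>B. \<forall>x. max (norm (fst (U x))) (norm (snd (U x))) \<le> B * norm x)}"

end

theory Submission
  imports Defs
begin

text \<open>
  Both inclusions compare the ranges of operators modulo closed subspaces of \<open>Y\<close>.

  \<^emph>\<open>Strictly cosingular operators are perturbations.\<close> Let \<open>T\<close> have a range of finite codimension and
  let \<open>S = T + K\<close> not have one. The claim is that \<open>K\<close> is onto modulo some closed \<open>N\<close> of infinite
  codimension. The range of \<open>T\<close> and a finite-dimensional \<open>F\<close> span \<open>Y\<close>, and by the open mapping theorem
  each \<open>y\<close> is, modulo \<open>F\<close>, of the form \<open>T x\<close> with \<open>\<parallel>x\<parallel> \<le> C \<parallel>y\<parallel>\<close>. This estimate persists modulo every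
  \<open>N \<supseteq> F\<close>. If moreover \<open>S\<close> has norm below \<open>1 / C\<close> as a map into \<open>Y/N\<close>, then \<open>K = S - T\<close> is a small
  perturbation of a surjection modulo \<open>N\<close> and hence itself onto modulo \<open>N\<close>. So the heart of the matter
  is to find such an \<open>N\<close> (\<open>not_finite_codim_imp_small_quotient\<close>): as \<open>S\<close> is not open modulo any
  finite-dimensional space, the Hahn-Banach theorem gives functionals that are bounded by 1 on the
  image of the unit ball and take the value 1 at arbitrarily small vectors. An inductive choice yields a
  biorthogonal system \<open>(g\<^sub>n, w\<^sub>n)\<close> for which \<open>A x = (\<Sum>n. g\<^sub>n (S x) w\<^sub>n)\<close> has small norm. The common
  kernel \<open>N\<close> of the \<open>g\<^sub>n\<close> has infinite codimension, and \<open>S\<close> agrees with \<open>A\<close> modulo \<open>N\<close>.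

  \<^emph>\<open>Perturbations are strictly cosingular.\<close> The class of perturbations is stable under composition
  with every operator \<open>V\<close> on \<open>X\<close>, because \<open>V\<close> is a sum of two invertible operators
  (\<open>perturbation_compose\<close>). Suppose that such a \<open>K\<close> is onto modulo a closed \<open>L\<close> of infinite codimension.
  By assumption there are \<open>N \<supseteq> L\<close>, still of infinite codimension, and an operator \<open>A\<close> from \<open>X\<close> onto
  \<open>N\<close>. If \<open>U = (U\<^sub>1, U\<^sub>2)\<close> maps \<open>X\<close> onto \<open>X \<times> X\<close>, then \<open>A U\<^sub>1 - K U\<^sub>2\<close> has range \<open>N + K X = Y\<close>,
  whereas adding the perturbation \<open>K U\<^sub>2\<close> leaves \<open>A U\<^sub>1\<close>, with range \<open>N\<close>: a contradiction.

  The Hahn-Banach theorem over the abstract scalar field needs to know that field. The first part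
  therefore shows that it is the field of real numbers or is generated over it by a square root
  of -1.
\<close>

section \<open>Real normed fields are real or complex\<close>

text \<open>
  For real \<open>x\<close> this is the squared modulus of \<open>x - w\<close>. In general it is a substitute for the norm of the
  product of \<open>x - w\<close> and \<open>x - cnj w\<close>, which has real coefficients and so makes sense in fields that
  do not contain \<open>w\<close>.
\<close>

definition quadratic_norm :: "'k::real_normed_field \<Rightarrow> complex \<Rightarrow> real" where
  "quadratic_norm x w = norm ((x - of_real (Re w))\<^sup>2 + of_real ((Im w)\<^sup>2))"

text \<open>
  The factorization \<open>(x - w) (x + w) = x\<^sup>2 - w\<^sup>2\<close>, multiplied by its conjugate.
\<close>

lemma quadratic_norm_square:
  "quadratic_norm (x\<^sup>2) (w\<^sup>2) = quadratic_norm x w * quadratic_norm x (- w)"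
proof -
  have "(x\<^sup>2 - of_real (Re (w\<^sup>2)))\<^sup>2 + of_real ((Im (w\<^sup>2))\<^sup>2) =
    ((x - of_real (Re w))\<^sup>2 + of_real ((Im w)\<^sup>2)) *
    ((x - of_real (Re (- w)))\<^sup>2 + of_real ((Im (- w))\<^sup>2))"
    by (simp add: Re_power2 Im_power2 power2_eq_square algebra_simps)
  then show ?thesis
    unfolding quadratic_norm_def by (metis norm_mult)
qed

text \<open>
  Each complex number is a square, so a lower bound for all \<open>w\<close> gets squared when \<open>x\<close> does.
\<close>

lemma quadratic_norm_power_ge:
  assumes "\<And>w. M \<le> quadratic_norm x w" and "0 \<le> M"
  shows "M ^ (2 ^ k) \<le> quadratic_norm (x ^ (2 ^ k)) w"
proof (induction k arbitrary: w)
  case (Suc k)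
  define v where "v = csqrt w"
  have w: "w = v\<^sup>2"
    by (simp add: v_def)
  have "M ^ (2 ^ Suc k) = M ^ (2 ^ k) * M ^ (2 ^ k)"
    by (simp add: mult_2 power_add)
  also have "\<dots> \<le> quadratic_norm (x ^ (2 ^ k)) v * quadratic_norm (x ^ (2 ^ k)) (- v)"
    using assms(2) by (intro mult_mono Suc.IH) (auto simp: quadratic_norm_def)
  also have "\<dots> = quadratic_norm ((x ^ (2 ^ k))\<^sup>2) w"
    unfolding w by (rule quadratic_norm_square [symmetric])
  also have "(x ^ (2 ^ k))\<^sup>2 = x ^ (2 ^ Suc k)"
    by (simp add: power_mult [symmetric] mult.commute)
  finally show ?case .
qed (use assms in simp)

text \<open>
  In the factorization of \<open>u\<^sup>n - e\<^sup>n\<close>, \<open>n = 2 ^ k\<close>, into \<open>u + e\<close>, \<open>u - e\<close>, \<open>u\<^sup>2 + e\<^sup>2\<close>, \<open>u\<^sup>4 + e\<^sup>4\<close>, and so on,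
  all factors other than \<open>u + e\<close> are bounded below by the powers of \<open>m\<close> of the same degree, while the
  product is at most \<open>m\<^sup>n + e\<^sup>n\<close>. Hence \<open>\<parallel>u + e\<parallel> \<le> m (1 + (e / m)\<^sup>n)\<close>, and \<open>n\<close> tends to infinity.
\<close>

lemma norm_add_of_real_le:
  fixes u :: "'k::real_normed_field"
  assumes m: "\<And>w. m\<^sup>2 \<le> quadratic_norm u w" and "norm u = m" and "0 < e" and "e < m"
  shows "norm (u + of_real e) \<le> m"
proof -
  define E where "E = (of_real e :: 'k)"
  have pow: "m ^ (2 ^ k) \<le> norm (u ^ (2 ^ k) - of_real c)" for k c
  proof -
    have "(m\<^sup>2) ^ (2 ^ k) \<le> quadratic_norm (u ^ (2 ^ k)) (of_real c)"
      using m by (intro quadratic_norm_power_ge) auto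
    also have "\<dots> = (norm (u ^ (2 ^ k) - of_real c))\<^sup>2"
      by (simp add: quadratic_norm_def norm_power)
    finally have "(m ^ (2 ^ k))\<^sup>2 \<le> (norm (u ^ (2 ^ k) - of_real c))\<^sup>2"
      by (simp add: power_mult [symmetric] mult.commute)
    then show ?thesis
      by (rule power2_le_imp_le) simp
  qed
  have mpos: "0 < m" using assms by linarith
  have prod: "norm (u + E) * m ^ (2 ^ k - 1) \<le> norm (u ^ (2 ^ k) - E ^ (2 ^ k))" if "k > 0" for k
    using that
  proof (induction k rule: nat_induct_non_zero)
    case 1
    have "norm (u + E) * m \<le> norm (u + E) * norm (u - E)"
      using pow [of 0 e] by (intro mult_left_mono) (auto simp: E_def)
    also have "\<dots> = norm (u\<^sup>2 - E\<^sup>2)"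
      by (simp add: norm_mult [symmetric] power2_eq_square algebra_simps)
    finally show ?case by simp
  next
    case (Suc k)
    let ?n = "2 ^ k :: nat"
    have "m ^ ?n \<le> norm (u ^ ?n + E ^ ?n)"
      using pow [of k "- (e ^ ?n)"] by (simp add: E_def)
    then have "(norm (u + E) * m ^ (?n - 1)) * m ^ ?n \<le>
        norm (u ^ ?n - E ^ ?n) * norm (u ^ ?n + E ^ ?n)"
      using Suc.IH mpos by (intro mult_mono) auto
    also have "\<dots> = norm (u ^ (2 * ?n) - E ^ (2 * ?n))"
      by (simp add: norm_mult [symmetric] mult_2 power_add algebra_simps)
    finally show ?case
      by (simp add: power_add [symmetric] mult.assoc mult_2)
  qed
  have bound: "norm (u + E) \<le> m + m * (e / m) ^ (2 ^ k)" if "k > 0" for k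
  proof -
    have "norm (u + E) * m ^ (2 ^ k - 1) \<le> norm (u ^ (2 ^ k)) + norm (E ^ (2 ^ k))"
      using prod [OF that] norm_triangle_ineq4 [of "u ^ (2 ^ k)" "E ^ (2 ^ k)"] by linarith
    also have "\<dots> = m ^ (2 ^ k) + e ^ (2 ^ k)"
      using assms by (simp add: E_def norm_power)
    also have "\<dots> = (m + m * (e / m) ^ (2 ^ k)) * m ^ (2 ^ k - 1)"
    proof -
      have "m ^ (2 ^ k) = m * m ^ (2 ^ k - 1)"
        using power_minus_mult [of "2 ^ k" m] by (simp add: mult.commute)
      moreover have "e ^ (2 ^ k) = (e / m) ^ (2 ^ k) * m ^ (2 ^ k)"
        using mpos by (simp add: power_divide)
      ultimately show ?thesis
        by (simp add: algebra_simps)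
    qed
    finally show ?thesis
      using mpos by simp
  qed
  have "(\<lambda>k. (e / m) ^ (2 ^ k)) \<longlonglongrightarrow> 0"
  proof (rule LIMSEQ_subseq_LIMSEQ [of "\<lambda>n. (e / m) ^ n" 0 "\<lambda>k. 2 ^ k", unfolded o_def])
    show "(\<lambda>n. (e / m) ^ n) \<longlonglongrightarrow> 0"
      using assms mpos by (intro LIMSEQ_power_zero) auto
    show "strict_mono (\<lambda>k. 2 ^ k :: nat)"
      by (simp add: strict_mono_def)
  qed
  then have "(\<lambda>k. m + m * (e / m) ^ (2 ^ k)) \<longlonglongrightarrow> m + m * 0"
    by (intro tendsto_intros)
  then have "norm (u + E) \<le> m + m * 0"
    using bound by (intro LIMSEQ_le_const) (auto intro!: exI [of _ 1])
  then show ?thesis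
    by (simp add: E_def)
qed

text \<open>
  This is Ostrowski's argument. The function \<open>quadratic_norm x\<close> attains its infimum \<open>m\<close>; among the
  minimizers choose \<open>z\<close> with the largest imaginary part in modulus. If \<open>m > 0\<close>, then replacing
  \<open>(Im z)\<^sup>2\<close> by \<open>(Im z)\<^sup>2 + e\<close> does not raise the value, by the previous lemma, which gives a minimizer
  with a larger imaginary part.
\<close>

lemma real_normed_field_quadratic:
  fixes x :: "'k::real_normed_field"
  obtains a b :: real where "(x - of_real a)\<^sup>2 + (of_real b)\<^sup>2 = 0"
proof -
  let ?q = "quadratic_norm x"
  \<comment> \<open>Outside the ball of radius \<open>R\<close> the function exceeds its value at 0.\<close>
  define R where "R = 3 * norm x + 1"
  have cont: "continuous_on S ?q" for S
    unfolding quadratic_norm_def by (intro continuous_intros)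
  have zero_in: "0 \<in> cball (0::complex) R" by (simp add: R_def)
  obtain w0 where w0: "w0 \<in> cball 0 R" "\<And>w. w \<in> cball 0 R \<Longrightarrow> ?q w0 \<le> ?q w"
    using continuous_attains_inf [OF compact_cball _ cont, of 0 R] zero_in by (metis empty_iff)
  have "?q 0 \<le> ?q w \<and> ?q 0 \<noteq> ?q w" if "w \<notin> cball 0 R" for w
  proof -
    have big: "norm w > R" using that by simp
    have eq: "(x - of_real (Re w))\<^sup>2 + of_real ((Im w)\<^sup>2) =
        of_real ((norm w)\<^sup>2) - (of_real (2 * Re w) * x - x\<^sup>2)"
      unfolding cmod_power2 by (simp add: power2_eq_square algebra_simps)
    have "norm (of_real (2 * Re w) * x - x\<^sup>2) \<le> norm (of_real (2 * Re w) * x) + norm (x\<^sup>2)"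
      by (rule norm_triangle_ineq4)
    also have "\<dots> = 2 * \<bar>Re w\<bar> * norm x + (norm x)\<^sup>2"
      by (simp add: norm_mult norm_power)
    also have "\<dots> \<le> 2 * norm w * norm x + (norm x)\<^sup>2"
      using abs_Re_le_cmod by (intro add_mono mult_right_mono) auto
    finally have "?q w \<ge> (norm w)\<^sup>2 - (2 * norm w * norm x + (norm x)\<^sup>2)"
      unfolding quadratic_norm_def eq
      using norm_triangle_ineq2 [of "of_real ((norm w)\<^sup>2) :: 'k" "of_real (2 * Re w) * x - x\<^sup>2"]
      by (simp add: norm_power del: of_real_mult)
    moreover have "(norm w - norm x)\<^sup>2 > (2 * norm x)\<^sup>2"
      using big by (intro power_strict_mono) (auto simp: R_def)
    then have "(norm w)\<^sup>2 > 2 * norm w * norm x + 3 * (norm x)\<^sup>2"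
      by (simp add: power2_eq_square algebra_simps)
    ultimately have "?q w > (norm x)\<^sup>2"
      using zero_le_power2 [of "norm x"] by linarith
    moreover have "?q 0 = (norm x)\<^sup>2"
      by (simp add: quadratic_norm_def norm_power)
    ultimately show ?thesis by simp
  qed
  note far = this
  define m where "m = ?q w0"
  have min: "m \<le> ?q w" for w
    using w0(2) [of w] w0(2) [OF zero_in] far [of w] unfolding m_def by fastforce
  define S where "S = {w \<in> cball 0 R. ?q w = m}"
  have "compact S"
  proof -
    have "closed {w. ?q w = m}"
      using cont [of UNIV] by (intro closed_Collect_eq) auto
    moreover have "S = cball 0 R \<inter> {w. ?q w = m}"
      by (auto simp: S_def)
    ultimately show ?thesis
      by (simp add: compact_Int_closed)
  qed
  moreover have "S \<noteq> {}"
    using w0 by (auto simp: S_def m_def)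
  moreover have "continuous_on S (\<lambda>w. (Im w)\<^sup>2)"
    by (intro continuous_intros)
  ultimately have "\<exists>z\<in>S. \<forall>w\<in>S. (Im w)\<^sup>2 \<le> (Im z)\<^sup>2"
    by (rule continuous_attains_sup)
  then obtain z where z: "z \<in> S" "\<And>w. w \<in> S \<Longrightarrow> (Im w)\<^sup>2 \<le> (Im z)\<^sup>2"
    by blast
  define u where "u = (x - of_real (Re z))\<^sup>2 + of_real ((Im z)\<^sup>2)"
  have um: "norm u = m"
    using z(1) by (simp add: S_def u_def quadratic_norm_def)
  have "m = 0"
  proof (rule ccontr)
    assume "m \<noteq> 0"
    then have mpos: "0 < m" using um by auto
    define e where "e = m / 2"
    have e: "0 < e" "e < m" using mpos by (auto simp: e_def)
    have "m\<^sup>2 \<le> quadratic_norm u w" for w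
    proof -
      define v where "v = csqrt (w - of_real ((Im z)\<^sup>2))"
      have vw: "v\<^sup>2 = w - of_real ((Im z)\<^sup>2)" by (simp add: v_def)
      let ?y = "x - of_real (Re z)"
      have "quadratic_norm u w = quadratic_norm (?y\<^sup>2) (v\<^sup>2)"
        unfolding vw by (simp add: quadratic_norm_def u_def algebra_simps)
      also have "\<dots> = quadratic_norm ?y v * quadratic_norm ?y (- v)"
        by (rule quadratic_norm_square)
      also have "\<dots> = ?q (of_real (Re z) + v) * ?q (of_real (Re z) - v)"
        by (simp add: quadratic_norm_def algebra_simps)
      also have "\<dots> \<ge> m * m"
        using mpos by (intro mult_mono min) (auto simp: quadratic_norm_def)
      finally show ?thesis by (simp add: power2_eq_square)
    qed
    then have le: "norm (u + of_real e) \<le> m"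
      using um e by (intro norm_add_of_real_le)
    define t where "t = Complex (Re z) (sqrt ((Im z)\<^sup>2 + e))"
    have "?q t = norm (u + of_real e)"
      using e by (simp add: t_def quadratic_norm_def u_def algebra_simps)
    then have qt: "?q t = m" using le min [of t] by simp
    have "t \<in> S"
    proof (rule ccontr)
      assume "t \<notin> S"
      then have "t \<notin> cball 0 R" using qt by (simp add: S_def)
      from far [OF this] show False using qt min [of 0] by simp
    qed
    from z(2) [OF this] e show False by (simp add: t_def)
  qed
  then have "u = 0" using um by simp
  then show ?thesis
    by (intro that [of "Re z" "Im z"]) (simp add: u_def)
qed

text \<open>
  A quadratic equation without a real solution yields a square root of -1 by completing the square;
  once there is such a root \<open>j\<close>, the quadratic of the previous lemma splits into two factors that are
  linear in \<open>x\<close>.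
\<close>

theorem real_normed_field_cases:
  obtains (real) "\<And>c :: 'k::real_normed_field. \<exists>a. c = of_real a"
  | (complex) j :: "'k::real_normed_field" where "j * j = -1" "\<And>c. \<exists>a b. c = of_real a + of_real b * j"
proof (cases "\<exists>j :: 'k::real_normed_field. j * j = -1")
  case True
  then obtain j :: 'k where j: "j * j = -1" by blast
  have "\<exists>a b. c = of_real a + of_real b * j" for c
  proof -
    obtain a b where ab: "(c - of_real a)\<^sup>2 + (of_real b)\<^sup>2 = 0"
      by (rule real_normed_field_quadratic)
    have "(c - of_real a - of_real b * j) * (c - of_real a + of_real b * j)
        = (c - of_real a)\<^sup>2 - (of_real b)\<^sup>2 * (j * j)"
      by (simp add: power2_eq_square algebra_simps)
    also have "\<dots> = 0" using ab j by simp
    finally have "c - of_real a - of_real b * j = 0 \<or> c - of_real a + of_real b * j = 0"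
      by simp
    then have "c = of_real a + of_real b * j \<or> c = of_real a + of_real (- b) * j"
      by (auto simp: algebra_simps eq_neg_iff_add_eq_0)
    then show ?thesis by blast
  qed
  with j show ?thesis by (rule complex)
next
  case False
  have "\<exists>a. c = of_real a" for c :: 'k
  proof -
    obtain a b where ab: "(c - of_real a)\<^sup>2 + (of_real b)\<^sup>2 = 0"
      by (rule real_normed_field_quadratic)
    have "b = 0"
    proof (rule ccontr)
      assume "b \<noteq> 0"
      then have "((c - of_real a) / of_real b) * ((c - of_real a) / of_real b) = -1"
        using ab by (simp add: field_simps power2_eq_square add_eq_0_iff2)
      with False show False by blast
    qed
    then show ?thesis using ab by auto
  qed
  then show ?thesis by (rule real)
qed

text \<open>
  The canonical map \<open>\<phi>\<close> from the complex numbers is multiplicative and satisfies \<open>\<parallel>\<phi> w\<parallel> \<le> 2 \<bar>w\<bar>\<close>. Applied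
  to the powers of \<open>w\<close>, this bound improves to \<open>\<parallel>\<phi> w\<parallel> \<le> \<bar>w\<bar>\<close>. The reverse estimate follows from
  \<open>\<phi> w * \<phi> (cnj w) = \<bar>w\<bar>\<^sup>2\<close>.
\<close>

lemma norm_of_complex_ge:
  fixes j :: "'k::real_normed_field"
  assumes j: "j * j = -1"
  shows "norm (of_real a + of_real b * j) \<ge> sqrt (a\<^sup>2 + b\<^sup>2)"
proof -
  define \<phi> where "\<phi> w = of_real (Re w) + of_real (Im w) * j" for w
  have mult: "\<phi> (v * w) = \<phi> v * \<phi> w" for v w
  proof -
    have "\<phi> v * \<phi> w = of_real (Re v) * of_real (Re w) + of_real (Im v) * of_real (Im w) * (j * j)
        + (of_real (Re v) * of_real (Im w) + of_real (Im v) * of_real (Re w)) * j"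
      by (simp add: \<phi>_def algebra_simps)
    then show ?thesis using j by (simp add: \<phi>_def algebra_simps)
  qed
  have pow: "\<phi> (w ^ n) = \<phi> w ^ n" for w n
    by (induction n) (auto simp: mult, simp add: \<phi>_def)
  have nj: "norm j = 1"
  proof -
    have "(norm j)\<^sup>2 = 1" using j by (metis norm_mult norm_minus_cancel norm_one power2_eq_square)
    then show ?thesis by (simp add: power2_eq_1_iff) (smt (verit) norm_ge_zero)
  qed
  have crude: "norm (\<phi> w) \<le> 2 * norm w" for w
  proof -
    have "norm (\<phi> w) \<le> \<bar>Re w\<bar> + \<bar>Im w\<bar>"
      unfolding \<phi>_def by (rule order_trans [OF norm_triangle_ineq]) (simp add: norm_mult nj)
    also have "\<dots> \<le> 2 * norm w" using abs_Re_le_cmod [of w] abs_Im_le_cmod [of w] by linarith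
    finally show ?thesis .
  qed
  have le: "norm (\<phi> w) \<le> norm w" for w
  proof (cases "w = 0")
    case False
    have "(norm (\<phi> w) / norm w) ^ n \<le> 2" for n
      using crude [of "w ^ n"] False by (simp add: pow norm_power power_divide field_simps)
    then have "\<not> norm (\<phi> w) / norm w > 1"
      by (metis real_arch_pow not_less)
    then show ?thesis using False by (simp add: field_simps)
  qed (simp add: \<phi>_def)
  show ?thesis
  proof (cases "Complex a b = 0")
    case False
    let ?w = "Complex a b"
    have "\<phi> ?w * \<phi> (cnj ?w) = of_real ((norm ?w)\<^sup>2)"
      unfolding mult [symmetric] by (simp add: \<phi>_def complex_mult_cnj cmod_power2)
    then have "norm (\<phi> ?w) * norm (\<phi> (cnj ?w)) = (norm ?w)\<^sup>2"
      by (metis norm_mult norm_of_real abs_power2 abs_norm_cancel)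
    moreover have "norm (\<phi> ?w) * norm (\<phi> (cnj ?w)) \<le> norm (\<phi> ?w) * norm ?w"
      using le [of "cnj ?w"] by (intro mult_left_mono) auto
    ultimately have "norm ?w * norm ?w \<le> norm (\<phi> ?w) * norm ?w"
      by (simp add: power2_eq_square)
    then have "norm ?w \<le> norm (\<phi> ?w)" using False by simp
    then show ?thesis by (simp add: \<phi>_def complex_norm)
  qed (auto simp: complex_eq_iff)
qed

section \<open>The Hahn-Banach theorem for seminorms\<close>

definition sublinear :: "('a::real_vector \<Rightarrow> real) \<Rightarrow> bool" where
  "sublinear p \<longleftrightarrow> (\<forall>x y. p (x + y) \<le> p x + p y) \<and> (\<forall>t\<ge>0. \<forall>x. p (t *\<^sub>R x) \<le> t * p x)"

lemma sublinear_zero: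
  assumes "sublinear p"
  shows "p 0 = 0"
proof (rule antisym)
  show "p 0 \<le> 0"
    using assms unfolding sublinear_def by (metis mult_zero_left order_refl scaleR_zero_left)
  have "p (0 + 0) \<le> p 0 + p 0"
    using assms unfolding sublinear_def by blast
  then show "0 \<le> p 0" by simp
qed

lemma sublinear_uminus_ge:
  assumes "sublinear p"
  shows "- p (- x) \<le> p x"
proof -
  have "p (x + - x) \<le> p x + p (- x)"
    using assms unfolding sublinear_def by blast
  then show ?thesis using sublinear_zero [OF assms] by simp
qed

lemma sublinear_scaleR:
  assumes "sublinear p" "0 \<le> t"
  shows "p (t *\<^sub>R x) = t * p x"
proof (cases "t = 0")
  case True
  then show ?thesis using sublinear_zero [OF assms(1)] by simp
next
  case False
  then have t: "0 < t" using assms by simp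
  have "p ((1 / t) *\<^sub>R t *\<^sub>R x) \<le> (1 / t) * p (t *\<^sub>R x)"
    using assms t unfolding sublinear_def by (meson divide_nonneg_nonneg zero_le_one)
  then have "t * p x \<le> p (t *\<^sub>R x)" using t by (simp add: field_simps)
  then show ?thesis using assms unfolding sublinear_def by (meson order_antisym)
qed

text \<open>
  The functional \<open>q y = (INF t\<in>{0..}. p (y + t x) - t * p x)\<close> lies below \<open>p\<close> and satisfies
  \<open>q (- x) \<le> - p x\<close>. It serves twice: to make a minimal sublinear functional additive, and to
  prescribe the value of a minimal functional at one point.
\<close>

lemma sublinear_directional:
  assumes p: "sublinear p"
  obtains q where "sublinear q" "\<And>y. q y \<le> p y" "\<And>y t. 0 \<le> t \<Longrightarrow> q y \<le> p (y + t *\<^sub>R x) - t * p x"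
proof
  define a where "a y t = p (y + t *\<^sub>R x) - t * p x" for y t
  define q where "q y = (INF t\<in>{0..}. a y t)" for y
  have add: "p (u + v) \<le> p u + p v" for u v using p by (simp add: sublinear_def)
  have lower: "- p (- y) \<le> a y t" if "0 \<le> t" for y t
    using add [of "y + t *\<^sub>R x" "- y"] sublinear_scaleR [OF p that, of x] by (simp add: a_def)
  have bdd: "bdd_below (a y ` {0..})" for y
    by (rule bdd_belowI [of _ "- p (- y)"]) (auto simp: lower)
  have q_le: "q y \<le> a y t" if "0 \<le> t" for y t
    unfolding q_def using that by (intro cINF_lower bdd) auto
  show q_dir: "q y \<le> p (y + t *\<^sub>R x) - t * p x" if "0 \<le> t" for y t
    using q_le [OF that, of y] by (simp add: a_def)
  show q_p: "q y \<le> p y" for y using q_dir [of 0 y] by simp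
  have "q (y + z) \<le> q y + q z" for y z
  proof -
    have "q (y + z) - a y t \<le> q z" if t: "0 \<le> t" for t
      unfolding q_def [of z]
    proof (intro cINF_greatest)
      fix s :: real assume "s \<in> {0..}"
      then have s: "0 \<le> s" by simp
      have "q (y + z) \<le> a (y + z) (t + s)" using t s by (intro q_le) simp
      also have "\<dots> \<le> a y t + a z s"
        using add [of "y + t *\<^sub>R x" "z + s *\<^sub>R x"] by (simp add: a_def algebra_simps)
      finally show "q (y + z) - a y t \<le> a z s" by simp
    qed auto
    then have "q (y + z) - q z \<le> a y t" if "0 \<le> t" for t using that by (simp add: algebra_simps)
    then have "q (y + z) - q z \<le> q y"
      unfolding q_def [of y] by (intro cINF_greatest) auto
    then show ?thesis by simp
  qed
  moreover have "q (c *\<^sub>R y) \<le> c * q y" if c: "0 \<le> c" for c y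
  proof (cases "c = 0")
    case True
    then show ?thesis using q_p [of 0] sublinear_zero [OF p] by simp
  next
    case False
    then have c: "0 < c" using c by simp
    have "q (c *\<^sub>R y) / c \<le> q y"
      unfolding q_def [of y]
    proof (intro cINF_greatest)
      fix t :: real assume "t \<in> {0..}"
      then have t: "0 \<le> t" by simp
      have "q (c *\<^sub>R y) \<le> a (c *\<^sub>R y) (c * t)" using c t by (intro q_le) simp
      also have "\<dots> = c * a y t"
        using sublinear_scaleR [OF p, of c "y + t *\<^sub>R x"] c by (simp add: a_def algebra_simps)
      finally show "q (c *\<^sub>R y) / c \<le> a y t" using c by (simp add: field_simps)
    qed auto
    then show ?thesis using c by (simp add: field_simps)
  qed
  ultimately show "sublinear q" by (simp add: sublinear_def)
qed

text \<open>
  By Zorn's lemma, as the pointwise infimum of a chain of sublinear functionals is sublinear.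
\<close>

lemma sublinear_minimal:
  assumes p: "sublinear p"
  obtains m where "sublinear m" "m \<le> p" "\<And>q. sublinear q \<Longrightarrow> q \<le> m \<Longrightarrow> q = m"
proof -
  let ?A = "{q. sublinear q \<and> q \<le> p}"
  let ?R = "\<lambda>f g :: 'a \<Rightarrow> real. g \<le> f"
  have "\<exists>m\<in>?A. \<forall>q\<in>?A. ?R m q \<longrightarrow> q = m"
  proof (rule predicate_Zorn)
    show "partial_order_on ?A (relation_of ?R ?A)"
      by (rule partial_order_on_relation_ofI) auto
  next
    fix C assume C: "C \<in> Chains (relation_of ?R ?A)"
    show "\<exists>u\<in>?A. \<forall>q\<in>C. ?R q u"
    proof (cases "C = {}")
      case True
      then show ?thesis using p by auto
    next
      case False
      have C_sub: "sublinear f" "f \<le> p" if "f \<in> C" for f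
        using C that by (auto simp: Chains_def relation_of_def)
      have C_chain: "f \<le> g \<or> g \<le> f" if "f \<in> C" "g \<in> C" for f g
        using C that by (auto simp: Chains_def relation_of_def)
      define u where "u x = (INF f\<in>C. f x)" for x
      have lower: "- p (- x) \<le> f x" if "f \<in> C" for f x
        using sublinear_uminus_ge [OF C_sub(1) [OF that], of x] C_sub(2) [OF that]
        by (smt (verit) le_funD)
      have bdd: "bdd_below ((\<lambda>f. f x) ` C)" for x
        by (rule bdd_belowI [of _ "- p (- x)"]) (auto simp: lower)
      have u_le: "u x \<le> f x" if "f \<in> C" for f x
        unfolding u_def using that by (intro cINF_lower bdd)
      have "u (x + y) \<le> u x + u y" for x y
      proof -
        have "u (x + y) - f x \<le> u y" if f: "f \<in> C" for f
          unfolding u_def [of y]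
        proof (intro cINF_greatest False)
          fix g assume g: "g \<in> C"
          have f': "f (x + y) \<le> f x + f y" and g': "g (x + y) \<le> g x + g y"
            using C_sub f g by (auto simp: sublinear_def)
          from C_chain [OF f g] show "u (x + y) - f x \<le> g y"
          proof
            assume "f \<le> g"
            then have "f y \<le> g y" by (rule le_funD)
            then show ?thesis using u_le [OF f, of "x + y"] f' by linarith
          next
            assume "g \<le> f"
            then have "g x \<le> f x" by (rule le_funD)
            then show ?thesis using u_le [OF g, of "x + y"] g' by linarith
          qed
        qed
        then have "u (x + y) - u y \<le> f x" if "f \<in> C" for f using that by (simp add: algebra_simps)
        then have "u (x + y) - u y \<le> u x"
          unfolding u_def [of x] using False by (intro cINF_greatest)
        then show ?thesis by simp
      qed
      moreover have "u (t *\<^sub>R x) \<le> t * u x" if t: "0 \<le> t" for t x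
      proof (cases "t = 0")
        case True
        obtain f where f: "f \<in> C" using False by blast
        show ?thesis using True u_le [OF f, of 0] sublinear_zero [OF C_sub(1) [OF f]] by simp
      next
        case nz: False
        have "u (t *\<^sub>R x) / t \<le> u x"
          unfolding u_def [of x]
        proof (intro cINF_greatest False)
          fix f assume f: "f \<in> C"
          show "u (t *\<^sub>R x) / t \<le> f x"
            using u_le [OF f, of "t *\<^sub>R x"] sublinear_scaleR [OF C_sub(1) [OF f] t, of x] nz t
            by (simp add: field_simps)
        qed
        then show ?thesis using nz t by (simp add: field_simps)
      qed
      ultimately have "sublinear u" by (simp add: sublinear_def)
      moreover have "u \<le> p"
        using False C_sub(2) u_le by (meson ex_in_conv le_fun_def order_trans)
      ultimately show ?thesis using u_le by (auto simp: le_fun_def)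
    qed
  qed
  then show ?thesis using that by auto
qed

text \<open>
  A minimal sublinear functional \<open>m\<close> coincides with all the functionals that \<open>sublinear_directional\<close>
  constructs below it, so that \<open>m y \<le> m (y + x) - m x\<close>; hence \<open>m\<close> is linear. If \<open>m\<close> is minimal below
  the functional that belongs to \<open>p\<close> and \<open>x0\<close>, then also \<open>m (- x0) \<le> - p x0\<close>.
\<close>

lemma sublinear_Hahn_Banach:
  fixes p :: "'a::real_vector \<Rightarrow> real"
  assumes p: "sublinear p"
  obtains f where "linear f" "\<And>x. f x \<le> p x" "f x0 = p x0"
proof -
  obtain p0 where p0: "sublinear p0" "\<And>y. p0 y \<le> p y"
      and dir: "\<And>y t. 0 \<le> t \<Longrightarrow> p0 y \<le> p (y + t *\<^sub>R x0) - t * p x0"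
    using sublinear_directional [OF p] by blast
  obtain m where m: "sublinear m" "m \<le> p0" and min: "\<And>q. sublinear q \<Longrightarrow> q \<le> m \<Longrightarrow> q = m"
    using sublinear_minimal [OF p0(1)] by blast
  have add: "m (x + y) = m x + m y" for x y
  proof -
    obtain q where q: "sublinear q" "\<And>y. q y \<le> m y" "\<And>z t. 0 \<le> t \<Longrightarrow> q z \<le> m (z + t *\<^sub>R x) - t * m x"
      using sublinear_directional [OF m(1)] by blast
    have "q = m" using q by (intro min) (auto simp: le_fun_def)
    then have "m y \<le> m (y + x) - m x" using q(3) [of 1 y] by simp
    moreover have "m (x + y) \<le> m x + m y" using m(1) by (simp add: sublinear_def)
    ultimately show ?thesis by (simp add: add.commute)
  qed
  have neg: "m (- x) = - m x" for x
    using add [of x "- x"] sublinear_zero [OF m(1)] by simp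
  have "m (t *\<^sub>R x) = t * m x" for t x
  proof (cases "0 \<le> t")
    case False
    then have "m ((- t) *\<^sub>R x) = (- t) * m x" by (intro sublinear_scaleR m) auto
    then show ?thesis by (simp add: neg)
  qed (auto intro: sublinear_scaleR m)
  then have "linear m" by (intro linearI) (auto simp: add)
  moreover have le: "m x \<le> p x" for x
    using m(2) p0(2) by (meson le_funD order_trans)
  moreover have "m x0 = p x0"
  proof (rule antisym)
    have "m (- x0) \<le> p0 (- x0)" using m(2) by (rule le_funD)
    also have "\<dots> \<le> - p x0" using dir [of 1 "- x0"] sublinear_zero [OF p] by simp
    finally show "p x0 \<le> m x0" by (simp add: neg)
  qed (rule le)
  ultimately show ?thesis by (rule that)
qed

text \<open>
  A real functional \<open>f\<close> below \<open>p\<close> is the real part of a unique functional \<open>g\<close> over the scalar field.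
  The bound for \<open>g\<close> follows from that for \<open>f\<close> by rotating the value \<open>g x\<close> to a real number.
\<close>

theorem seminorm_Hahn_Banach:
  fixes scale :: "'k::real_normed_field \<Rightarrow> 'a::banach \<Rightarrow> 'a"
  assumes "banach_over scale"
    and add: "\<And>x y. p (x + y) \<le> p x + p y"
    and hom: "\<And>c x. p (scale c x) = norm c * p x"
  obtains g where "Vector_Spaces.linear scale (*) g" "\<And>x. norm (g x) \<le> p x" "norm (g x0) = p x0"
proof -
  interpret banach_over scale by fact
  have homR: "p (t *\<^sub>R x) = \<bar>t\<bar> * p x" for t x
    using hom [of "of_real t" x] by (simp add: scale_of_real)
  have "sublinear p" by (auto simp: sublinear_def add homR)
  then obtain f where f: "linear f" "\<And>x. f x \<le> p x" "f x0 = p x0"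
    using sublinear_Hahn_Banach [of p x0] by blast
  have f_add: "f (x + y) = f x + f y" and f_scale: "f (t *\<^sub>R x) = t * f x" for x y t
    using f(1) by (simp_all add: linear_add linear_scale)
  have vs: "vector_space scale" "vector_space ((*) :: 'k \<Rightarrow> 'k \<Rightarrow> 'k)"
    by unfold_locales (auto simp: algebra_simps)
  show ?thesis
  proof (rule real_normed_field_cases [where 'k = 'k])
    assume real: "\<And>c :: 'k. \<exists>a. c = of_real a"
    define g where "g x = (of_real (f x) :: 'k)" for x
    have "f (scale c x) = a * f x" if "c = of_real a" for c a x
      using that by (simp add: scale_of_real f_scale)
    then have "Vector_Spaces.linear scale (*) g"
      unfolding Vector_Spaces.linear_iff using vs real
      by (auto simp: g_def f_add) (metis of_real_mult)
    moreover have "norm (g x) \<le> p x" for x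
      using f(2) [of x] f(2) [of "- x"] homR [of "-1" x] f_scale [of "-1" x] by (simp add: g_def)
    moreover have "0 \<le> p x0" using add [of x0 "- x0"] homR [of "-1" x0] homR [of 0 x0] by simp
    then have "norm (g x0) = p x0" by (simp add: g_def f(3))
    ultimately show ?thesis by (rule that)
  next
    fix j :: 'k assume j: "j * j = -1" and rep: "\<And>c. \<exists>a b. c = of_real a + of_real b * j"
    \<comment> \<open>The formula is forced by \<open>Re (g x) = f x\<close> and \<open>g (j x) = j * g x\<close>.\<close>
    define g where "g x = of_real (f x) - of_real (f (scale j x)) * j" for x
    have fc: "f (scale (of_real a + of_real b * j) x) = a * f x + b * f (scale j x)" for a b x
      by (simp add: scale_left_distrib f_add scale_of_real f_scale flip: scale_scale)
    have "g (scale c x) = c * g x" for c x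
    proof -
      obtain a b where c: "c = of_real a + of_real b * j" using rep by blast
      have jc: "j * c = of_real (- b) + of_real a * j"
      proof -
        have "j * c = of_real b * (j * j) + of_real a * j"
          by (simp add: c algebra_simps)
        then show ?thesis by (simp add: j)
      qed
      have "g (scale c x) = of_real (a * f x + b * f (scale j x))
          - of_real (- b * f x + a * f (scale j x)) * j"
        unfolding g_def scale_scale jc fc by (simp add: c fc)
      also have "\<dots> = of_real a * of_real (f x) - of_real b * of_real (f (scale j x)) * (j * j)
          - of_real a * of_real (f (scale j x)) * j + of_real b * of_real (f x) * j"
        by (simp add: j algebra_simps)
      also have "\<dots> = c * g x" by (simp add: c g_def algebra_simps)
      finally show ?thesis .
    qed
    then have lin: "Vector_Spaces.linear scale (*) g"
      unfolding Vector_Spaces.linear_iff using vs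
      by (auto simp: g_def f_add scale_right_distrib algebra_simps)
    have ge: "f x \<le> norm (g x)" for x
    proof -
      have "f x \<le> sqrt ((f x)\<^sup>2 + (- f (scale j x))\<^sup>2)" by (simp add: real_le_rsqrt)
      also have "\<dots> \<le> norm (of_real (f x) + of_real (- f (scale j x)) * j)"
        by (rule norm_of_complex_ge [OF j])
      finally show ?thesis by (simp add: g_def)
    qed
    have le: "norm (g x) \<le> p x" for x
    proof (cases "g x = 0")
      case True
      have "0 \<le> p x" using add [of x "- x"] homR [of "-1" x] homR [of 0 x] by simp
      then show ?thesis using True by simp
    next
      case False
      define c where "c = of_real (norm (g x)) / g x"
      have nc: "norm c = 1" using False by (simp add: c_def norm_divide)
      have "g (scale c x) = c * g x"
        using lin by (simp add: Vector_Spaces.linear_iff)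
      also have "\<dots> = of_real (norm (g x))" using False by (simp add: c_def)
      finally have eq: "of_real (f (scale c x) - norm (g x)) = of_real (f (scale j (scale c x))) * j"
        by (simp add: g_def algebra_simps)
      have "f (scale c x) = norm (g x)"
      proof -
        let ?r = "f (scale c x) - norm (g x)"
        have "(of_real ?r * of_real ?r :: 'k) = of_real ((f (scale j (scale c x)))\<^sup>2) * (j * j)"
          unfolding eq by (simp add: power2_eq_square algebra_simps)
        then have "(of_real ?r * of_real ?r :: 'k) = of_real (- (f (scale j (scale c x)))\<^sup>2)"
          by (simp add: j)
        then have "?r * ?r = - (f (scale j (scale c x)))\<^sup>2"
          by (metis of_real_eq_iff of_real_mult)
        then have "?r * ?r \<le> 0" by simp
        then show ?thesis unfolding mult_le_0_iff by linarith
      qed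
      then show ?thesis using f(2) [of "scale c x"] hom [of c x] nc by simp
    qed
    show ?thesis using lin le f(3) ge [of x0] le [of x0] by (intro that) auto
  qed
qed

section \<open>Open mappings modulo a closed subspace\<close>

text \<open>
  Successive approximation: solve approximately for the remainder, and again for the new remainder,
  which shrinks geometrically. The summands from \<open>F\<close> need not converge; only the limit of \<open>y - S x\<close>
  has to be in \<open>F\<close>, which holds because \<open>F\<close> is closed.
\<close>

lemma approximately_solvable_imp_solvable:
  fixes S :: "'a::banach \<Rightarrow> 'b::real_normed_vector"
  assumes S: "bounded_linear S" and F: "subspace F" "closed F"
    and C: "0 \<le> C" and q: "0 \<le> q" "q < 1"
    and approx: "\<And>y. \<exists>x f. f \<in> F \<and> norm x \<le> C * norm y \<and> norm (y - S x - f) \<le> q * norm y"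
  shows "\<exists>x. y - S x \<in> F \<and> norm x \<le> C / (1 - q) * norm y"
proof -
  interpret S: bounded_linear S by (rule S)
  obtain h k where hk: "\<And>y. k y \<in> F" "\<And>y. norm (h y) \<le> C * norm y"
      "\<And>y. norm (y - S (h y) - k y) \<le> q * norm y"
    using approx by metis
  define r where "r = rec_nat y (\<lambda>_ z. z - S (h z) - k z)"
  have r0: "r 0 = y" and rS: "r (Suc n) = r n - S (h (r n)) - k (r n)" for n
    by (simp_all add: r_def)
  have rn: "norm (r n) \<le> norm y * q ^ n" for n
  proof (induction n)
    case (Suc n)
    have "norm (r (Suc n)) \<le> q * norm (r n)" unfolding rS by (rule hk)
    also have "\<dots> \<le> q * (norm y * q ^ n)" using Suc q by (intro mult_left_mono)
    finally show ?case by (simp add: mult_ac)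
  qed (simp add: r0)
  have xn: "norm (h (r n)) \<le> C * norm y * q ^ n" for n
  proof -
    have "norm (h (r n)) \<le> C * norm (r n)" by (rule hk)
    also have "\<dots> \<le> C * (norm y * q ^ n)" using rn C by (intro mult_left_mono)
    finally show ?thesis by (simp add: mult_ac)
  qed
  have geo: "(\<lambda>n. C * norm y * q ^ n) sums (C * norm y * (1 / (1 - q)))"
    using q by (intro sums_mult geometric_sums) auto
  have sumn: "summable (\<lambda>n. norm (h (r n)))"
    by (rule summable_comparison_test' [OF sums_summable [OF geo], of 0]) (simp add: xn)
  define x where "x = (\<Sum>n. h (r n))"
  have lim: "(\<lambda>n. \<Sum>i<n. h (r i)) \<longlonglongrightarrow> x"
    unfolding x_def using summable_norm_cancel [OF sumn] by (rule summable_LIMSEQ)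
  have inF: "y - S (\<Sum>i<n. h (r i)) - r n \<in> F" for n
  proof (induction n)
    case 0
    show ?case using F by (simp add: r0 S.zero subspace_0)
  next
    case (Suc n)
    have "y - S (\<Sum>i<Suc n. h (r i)) - r (Suc n) = (y - S (\<Sum>i<n. h (r i)) - r n) + k (r n)"
      by (simp add: rS S.add)
    then show ?case using subspace_add [OF F(1) Suc hk(1)] by (simp only:)
  qed
  have "(\<lambda>n. norm y * q ^ n) \<longlonglongrightarrow> norm y * 0"
    using q by (intro tendsto_intros LIMSEQ_power_zero) auto
  then have "(\<lambda>n. norm y * q ^ n) \<longlonglongrightarrow> 0" by simp
  then have r_lim: "r \<longlonglongrightarrow> 0"
    by (rule Lim_null_comparison [rotated]) (simp add: rn)
  have "(\<lambda>n. y - S (\<Sum>i<n. h (r i)) - r n) \<longlonglongrightarrow> y - S x - 0"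
    by (intro tendsto_diff tendsto_const r_lim S.tendsto lim)
  then have "y - S x \<in> F"
    using closed_sequentially [OF F(2)] inF by fastforce
  moreover have "norm x \<le> (\<Sum>n. norm (h (r n)))"
    unfolding x_def by (rule summable_norm [OF sumn])
  then have "norm x \<le> C * norm y * (1 / (1 - q))"
    using suminf_le [OF xn sumn sums_summable [OF geo]] sums_unique [OF geo] by linarith
  ultimately show ?thesis by (intro exI [of _ x]) (simp add: mult_ac)
qed

lemma solvable_of_approximately_open:
  fixes S :: "'a::banach \<Rightarrow> 'b::real_normed_vector"
  assumes S: "bounded_linear S" and F: "subspace F" "closed F"
    and d: "0 < d" and R: "0 \<le> R"
    and approx: "\<And>y. norm y = d \<Longrightarrow> \<exists>x f. f \<in> F \<and> norm x \<le> R \<and> norm (y - S x - f) \<le> d / 2"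
  obtains C where "0 \<le> C" "\<And>y. \<exists>x. y - S x \<in> F \<and> norm x \<le> C * norm y"
proof -
  interpret S: bounded_linear S by (rule S)
  have "\<exists>x f. f \<in> F \<and> norm x \<le> R / d * norm y \<and> norm (y - S x - f) \<le> 1 / 2 * norm y" for y
  proof (cases "y = 0")
    case True
    then show ?thesis using F by (intro exI [of _ 0]) (auto simp: S.zero subspace_0)
  next
    case False
    define t where "t = norm y / d"
    have t: "0 < t" using False d by (simp add: t_def)
    have "norm ((1 / t) *\<^sub>R y) = d" using False d by (simp add: t_def)
    from approx [OF this] obtain x f where
      xf: "f \<in> F" "norm x \<le> R" "norm ((1 / t) *\<^sub>R y - S x - f) \<le> d / 2" by blast
    have "y - S (t *\<^sub>R x) - t *\<^sub>R f = t *\<^sub>R ((1 / t) *\<^sub>R y - S x - f)"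
      using t by (simp add: S.scaleR algebra_simps)
    then have "norm (y - S (t *\<^sub>R x) - t *\<^sub>R f) \<le> t * (d / 2)"
      using t xf(3) by simp
    moreover have "norm (t *\<^sub>R x) \<le> t * R" using t xf(2) by simp
    moreover have "t *\<^sub>R f \<in> F" using F xf(1) by (simp add: subspace_scale)
    ultimately show ?thesis
      using d by (intro exI [of _ "t *\<^sub>R x"] exI [of _ "t *\<^sub>R f"]) (simp add: t_def field_simps)
  qed
  then have "\<exists>x. y - S x \<in> F \<and> norm x \<le> (R / d) / (1 - 1 / 2) * norm y" for y
    using d R by (intro approximately_solvable_imp_solvable S F) auto
  then show ?thesis using d R by (intro that [of "(R / d) / (1 - 1 / 2)"]) auto
qed

text \<open>
  The open mapping theorem for the map into the quotient by \<open>F\<close>. By Baire's theorem the closure of some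
  \<open>{T x + f |x f. \<parallel>x\<parallel> \<le> n \<and> f \<in> F}\<close> contains a ball, and differences of its points approximate the
  points of a ball about the origin.
\<close>

lemma open_mapping_modulo:
  fixes T :: "'a::banach \<Rightarrow> 'b::banach"
  assumes T: "bounded_linear T" and F: "subspace F" "closed F"
    and onto: "\<And>y. \<exists>x. y - T x \<in> F"
  obtains C where "0 \<le> C" "\<And>y. \<exists>x. y - T x \<in> F \<and> norm x \<le> C * norm y"
proof -
  interpret T: bounded_linear T by (rule T)
  define D where "D n = {T x + f |x f. norm x \<le> real n \<and> f \<in> F}" for n :: nat
  have cover: "(\<Union>n. closure (D n)) = UNIV"
  proof -
    have "y \<in> (\<Union>n. closure (D n))" for y
    proof -
      obtain x where x: "y - T x \<in> F" using onto by blast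
      obtain n where "norm x \<le> real n" using real_arch_simple by blast
      then have "y \<in> D n" unfolding D_def using x by (intro CollectI exI [of _ x] exI [of _ "y - T x"]) simp
      then show ?thesis using closure_subset by blast
    qed
    then show ?thesis by blast
  qed
  have "\<exists>n. interior (closure (D n)) \<noteq> {}"
  proof (rule ccontr)
    assume "\<not> ?thesis"
    then have "euclidean interior_of \<Union> (range (\<lambda>n. closure (D n))) = {}"
      by (intro Baire_category_alt)
        (auto simp: completely_metrizable_space_euclidean simp flip: closed_closedin)
    then show False using cover by simp
  qed
  then obtain n y0 where "y0 \<in> interior (closure (D n))" by blast
  then obtain r where r: "0 < r" "ball y0 r \<subseteq> closure (D n)"
    by (meson mem_interior)
  define d where "d = r / 2"
  have d: "0 < d" using r by (simp add: d_def)
  have "\<exists>x f. f \<in> F \<and> norm x \<le> 2 * real n \<and> norm (y - T x - f) \<le> d / 2" if y: "norm y = d" for y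
  proof -
    have "y0 + y \<in> closure (D n)" "y0 \<in> closure (D n)"
      using r y d by (auto simp: dist_norm d_def intro!: subsetD [OF r(2)])
    then obtain z1 z2 where z: "z1 \<in> D n" "z2 \<in> D n"
        "dist z1 (y0 + y) < d / 4" "dist z2 y0 < d / 4"
      using d by (meson closure_approachable divide_pos_pos zero_less_numeral)
    from z(1,2) obtain x1 f1 x2 f2 where x:
        "z1 = T x1 + f1" "norm x1 \<le> real n" "f1 \<in> F" "z2 = T x2 + f2" "norm x2 \<le> real n" "f2 \<in> F"
      unfolding D_def by blast
    have "y - T (x1 - x2) - (f1 - f2) = (z2 - y0) - (z1 - (y0 + y))"
      by (simp add: x T.diff)
    then have "norm (y - T (x1 - x2) - (f1 - f2)) = norm ((z2 - y0) - (z1 - (y0 + y)))"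
      by (simp only:)
    then have "norm (y - T (x1 - x2) - (f1 - f2)) \<le> d / 4 + d / 4"
      using z(3,4) norm_triangle_ineq4 [of "z2 - y0" "z1 - (y0 + y)"] unfolding dist_norm by linarith
    moreover have "norm (x1 - x2) \<le> 2 * real n"
      using x norm_triangle_ineq4 [of x1 x2] by simp
    moreover have "f1 - f2 \<in> F" using F x by (simp add: subspace_diff)
    ultimately show ?thesis by (intro exI [of _ "x1 - x2"] exI [of _ "f1 - f2"]) simp
  qed
  then show ?thesis
    using solvable_of_approximately_open [OF T F d, of "2 * real n"] that by auto
qed

section \<open>Cosets and codimension\<close>

lemma linear_bounded_imp_bounded_linear:
  assumes "Vector_Spaces.linear s1 s2 T"
    and "\<And>r x. s1 (of_real r) x = r *\<^sub>R x" "\<And>r x. s2 (of_real r) x = r *\<^sub>R x"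
    and "\<And>x. norm (T x) \<le> B * norm x"
  shows "bounded_linear T"
proof (rule bounded_linear_intro)
  show "T (x + y) = T x + T y" for x y
    using assms(1) by (simp add: Vector_Spaces.linear_iff)
  show "T (r *\<^sub>R x) = r *\<^sub>R T x" for r x
    using assms by (metis Vector_Spaces.linear_iff)
  show "norm (T x) \<le> norm x * B" for x
    using assms(4) [of x] by (simp add: mult.commute)
qed

lemma quot_map_eq_iff:
  assumes "module s" "module.subspace s M"
  shows "quot_map M x = quot_map M y \<longleftrightarrow> x - y \<in> M"
proof -
  interpret module s by fact
  have "x \<in> quot_map M x"
    using subspace_0 [OF assms(2)] by (auto simp: quot_map_def intro: exI [of _ 0])
  moreover have "quot_map M x \<subseteq> quot_map M y" if d: "x - y \<in> M" for x y
  proof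
    fix z assume "z \<in> quot_map M x"
    then obtain m where m: "z = x + m" "m \<in> M" by (auto simp: quot_map_def)
    then have "z = y + (x - y + m)" by simp
    then show "z \<in> quot_map M y"
      using subspace_add [OF assms(2) d m(2)] unfolding quot_map_def by blast
  qed
  moreover have "y - x \<in> M" if "x - y \<in> M"
    using subspace_neg [OF assms(2) that] by simp
  moreover have "x - y \<in> M" if "x \<in> quot_map M y"
    using that by (auto simp: quot_map_def)
  ultimately show ?thesis
    by blast
qed

lemma quot_map_image_eq_quot_iff:
  assumes "module s" "module.subspace s M"
  shows "quot_map M ` D = quot M \<longleftrightarrow> (\<forall>y. \<exists>d\<in>D. y - d \<in> M)"
proof -
  have "quot_map M ` D = quot M \<longleftrightarrow> range (quot_map M) \<subseteq> quot_map M ` D"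
    unfolding quot_def by auto
  also have "\<dots> \<longleftrightarrow> (\<forall>y. \<exists>d\<in>D. quot_map M y = quot_map M d)"
    by (simp add: image_subset_iff image_iff)
  finally show ?thesis by (simp add: quot_map_eq_iff [OF assms])
qed

lemma range_quot_map_comp_eq_quot_iff:
  assumes "module s" "module.subspace s N"
  shows "range (quot_map N \<circ> T) = quot N \<longleftrightarrow> (\<forall>y. \<exists>x. y - T x \<in> N)"
  using quot_map_image_eq_quot_iff [OF assms, of "range T"] by (simp add: image_comp)

lemma finite_codim_iff:
  assumes "module s" "module.subspace s M"
  shows "finite_codim s M \<longleftrightarrow> (\<exists>B. finite B \<and> (\<forall>y. \<exists>b\<in>module.span s B. y - b \<in> M))"
  by (simp add: finite_codim_def quot_map_image_eq_quot_iff [OF assms])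

section \<open>Functionals that are small on the range of an operator\<close>

locale banach_pair = X: banach_over sX + Y: banach_over sY
  for sX :: "'k::real_normed_field \<Rightarrow> 'a::banach \<Rightarrow> 'a"
    and sY :: "'k \<Rightarrow> 'b::banach \<Rightarrow> 'b"
begin

lemma bounded_ops_imp_bounded_linear: "T \<in> bounded_ops sX sY \<Longrightarrow> bounded_linear T"
  unfolding bounded_ops_def
  by (auto intro: linear_bounded_imp_bounded_linear X.scale_of_real Y.scale_of_real)

lemma subspace_range: "T \<in> bounded_ops sX sY \<Longrightarrow> Y.subspace (range T)"
  unfolding bounded_ops_def
  by (auto intro!: module_hom.subspace_image [OF module_hom_linearI] simp: X.subspace_UNIV)

end

context banach_over
begin

lemma real_subspace: "subspace M \<Longrightarrow> real_vector.subspace M"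
  unfolding real_vector.subspace_def subspace_def by (metis scale_of_real)

lemma bounded_linear_functional:
  assumes "Vector_Spaces.linear scale (*) g" "\<And>x. norm (g x) \<le> C * norm x"
  shows "bounded_linear g"
  by (rule linear_bounded_imp_bounded_linear [OF assms(1) _ _ assms(2)])
    (auto simp: scale_of_real scaleR_conv_of_real)

end

context banach_pair
begin

text \<open>
  The seminorm \<open>p y = inf {\<parallel>x\<parallel> + \<parallel>y - S x - f\<parallel> / \<rho> |x f. f \<in> F}\<close> is the gauge of the convex hull of
  the image of the unit ball, of \<open>F\<close> and of a ball of radius \<open>\<rho>\<close>. It vanishes on \<open>F\<close> and satisfies
  \<open>p (S x) \<le> \<parallel>x\<parallel>\<close> and \<open>p y \<le> \<parallel>y\<parallel> / \<rho>\<close>; the distance from \<open>b\<close> to \<open>S x + F\<close> for \<open>\<parallel>x\<parallel> \<le> 1\<close> yields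
  \<open>p b \<ge> 1\<close>. The functional is a Hahn-Banach functional for \<open>p\<close> at \<open>b\<close>.
\<close>

lemma functional_separating:
  assumes S: "S \<in> bounded_ops sX sY" and F: "Y.subspace F" and \<rho>: "0 < \<rho>"
    and far: "\<And>x f. norm x \<le> 1 \<Longrightarrow> f \<in> F \<Longrightarrow> \<rho> \<le> norm (b - S x - f)"
  obtains g c where "Vector_Spaces.linear sY (*) g" "bounded_linear g" "\<And>f. f \<in> F \<Longrightarrow> g f = 0"
    "\<And>x. norm (g (S x)) \<le> norm x" "g (sY c b) = 1" "norm c \<le> 1"
proof -
  interpret S: bounded_linear S using S by (rule bounded_ops_imp_bounded_linear)
  have S_scale: "S (sX c x) = sY c (S x)" for c x
    using S by (simp add: bounded_ops_def Vector_Spaces.linear_iff)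
  define a where "a y z = norm (fst z) + norm (y - S (fst z) - snd z) / \<rho>" for y z
  define p where "p y = (INF z\<in>UNIV \<times> F. a y z)" for y
  have a_nonneg: "0 \<le> a y z" for y z using \<rho> by (simp add: a_def)
  have bdd: "bdd_below (a y ` (UNIV \<times> F))" for y
    by (rule bdd_belowI [of _ 0]) (auto simp: a_nonneg)
  have ne: "UNIV \<times> F \<noteq> {}" using Y.subspace_0 [OF F] by auto
  have p_le: "p y \<le> norm x + norm (y - S x - f) / \<rho>" if "f \<in> F" for y x f
  proof -
    have "p y \<le> a y (x, f)" unfolding p_def using that by (intro cINF_lower bdd) auto
    then show ?thesis by (simp add: a_def)
  qed
  have p_ge: "r \<le> p y" if "\<And>x f. f \<in> F \<Longrightarrow> r \<le> norm x + norm (y - S x - f) / \<rho>" for r y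
    unfolding p_def using that ne by (intro cINF_greatest) (auto simp: a_def)
  have p_add: "p (y + z) \<le> p y + p z" for y z
  proof -
    have "p (y + z) - p z \<le> p y"
    proof (rule p_ge)
      fix x f assume f: "f \<in> F"
      have "p (y + z) - (norm x + norm (y - S x - f) / \<rho>) \<le> p z"
      proof (rule p_ge)
        fix x' f' assume f': "f' \<in> F"
        have "p (y + z) \<le> norm (x + x') + norm (y + z - S (x + x') - (f + f')) / \<rho>"
          using f f' F by (intro p_le Y.subspace_add)
        moreover have "norm (x + x') \<le> norm x + norm x'" by (rule norm_triangle_ineq)
        moreover have "y + z - S (x + x') - (f + f') = (y - S x - f) + (z - S x' - f')"
          by (simp add: S.add)
        then have "norm (y + z - S (x + x') - (f + f')) / \<rho> \<le> (norm (y - S x - f) + norm (z - S x' - f')) / \<rho>"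
          using \<rho> by (metis divide_right_mono less_imp_le norm_triangle_ineq)
        ultimately show "p (y + z) - (norm x + norm (y - S x - f) / \<rho>) \<le> norm x' + norm (z - S x' - f') / \<rho>"
          by (simp add: add_divide_distrib)
      qed
      then show "p (y + z) - p z \<le> norm x + norm (y - S x - f) / \<rho>" by simp
    qed
    then show ?thesis by simp
  qed
  have p_zero: "p 0 = 0"
  proof (rule antisym)
    show "p 0 \<le> 0" using p_le [OF Y.subspace_0 [OF F], of 0 0] by (simp add: S.zero)
    show "0 \<le> p 0" by (rule p_ge) (use \<rho> in auto)
  qed
  have p_scale_le: "p (sY c y) \<le> norm c * p y" if c: "c \<noteq> 0" for c y
  proof -
    have "p (sY c y) / norm c \<le> p y"
    proof (rule p_ge)
      fix x f assume f: "f \<in> F"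
      have "p (sY c y) \<le> norm (sX c x) + norm (sY c y - S (sX c x) - sY c f) / \<rho>"
        using f F by (intro p_le Y.subspace_scale)
      also have "sY c y - S (sX c x) - sY c f = sY c (y - S x - f)"
        by (simp add: S_scale Y.scale_right_diff_distrib)
      also have "norm (sX c x) + norm (sY c (y - S x - f)) / \<rho>
          = norm c * (norm x + norm (y - S x - f) / \<rho>)"
        by (simp only: X.norm_scale Y.norm_scale distrib_left times_divide_eq_right)
      finally show "p (sY c y) / norm c \<le> norm x + norm (y - S x - f) / \<rho>"
        using c by (simp only: divide_le_eq mult.commute) simp
    qed
    then show ?thesis using c by (simp add: field_simps)
  qed
  have p_scale: "p (sY c y) = norm c * p y" for c y
  proof (cases "c = 0")
    case False
    have "p (sY (inverse c) (sY c y)) \<le> norm (inverse c) * p (sY c y)"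
      using False by (intro p_scale_le) simp
    then have "norm c * p y \<le> p (sY c y)"
      using False by (simp add: field_simps norm_divide)
    then show ?thesis using p_scale_le [OF False, of y] by simp
  qed (simp add: p_zero)
  obtain g where g: "Vector_Spaces.linear sY (*) g" "\<And>y. norm (g y) \<le> p y" "norm (g b) = p b"
    using seminorm_Hahn_Banach [OF Y.banach_over_axioms p_add p_scale, of b] by blast
  have "1 \<le> p b"
  proof (rule p_ge)
    fix x f assume f: "f \<in> F"
    show "1 \<le> norm x + norm (b - S x - f) / \<rho>"
    proof (cases "norm x \<le> 1")
      case True
      then have "1 \<le> norm (b - S x - f) / \<rho>" using far [OF True f] \<rho> by simp
      then show ?thesis by (simp add: add_increasing)
    next
      case False
      then show ?thesis using \<rho> by (simp add: add_increasing2)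
    qed
  qed
  then have gb: "1 \<le> norm (g b)" by (simp add: g(3))
  have F0: "g f = 0" if "f \<in> F" for f
  proof -
    have "p f \<le> 0" using p_le [OF that, of f 0] by (simp add: S.zero)
    then have "norm (g f) \<le> 0" using g(2) [of f] by linarith
    then show ?thesis by simp
  qed
  have gS: "norm (g (S x)) \<le> norm x" for x
    using g(2) [of "S x"] p_le [OF Y.subspace_0 [OF F], of "S x" x] by simp
  have "norm (g y) \<le> 1 / \<rho> * norm y" for y
    using g(2) [of y] p_le [OF Y.subspace_0 [OF F], of y 0] by (simp add: S.zero)
  then have "bounded_linear g" by (rule Y.bounded_linear_functional [OF g(1)])
  moreover have "g (sY (inverse (g b)) b) = 1"
  proof -
    have "g (sY (inverse (g b)) b) = inverse (g b) * g b"
      using g(1) by (simp add: Vector_Spaces.linear_iff)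
    moreover have "g b \<noteq> 0" using gb by auto
    ultimately show ?thesis by simp
  qed
  moreover have "norm (inverse (g b)) \<le> 1"
    using gb by (simp add: norm_inverse inverse_le_1_iff)
  ultimately show ?thesis using g(1) F0 gS by (intro that)
qed

end

text \<open>
  If \<open>span B\<close> is closed and does not contain \<open>b\<close>, then a bounded functional \<open>g\<close> vanishes on \<open>span B\<close> but
  not at \<open>b\<close>. With \<open>g\<close> one can recover the component along \<open>b\<close> of an element of
  \<open>span (insert b B)\<close> continuously, so that this span is a preimage of \<open>span B\<close> under a continuous map.
\<close>

lemma (in banach_over) closed_span_finite:
  assumes "finite B"
  shows "closed (span B)"
  using assms
proof (induction B)
  case (insert b B)
  show ?case
  proof (cases "b \<in> span B")
    case True
    then show ?thesis using insert by (simp add: span_redundant)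
  next
    case False
    \<comment> \<open>For the zero operator, \<open>functional_separating\<close> separates \<open>b\<close> from \<open>span B\<close> alone.\<close>
    interpret P: banach_pair scale scale by unfold_locales
    have z: "(\<lambda>x. 0) \<in> bounded_ops scale scale"
      unfolding bounded_ops_def Vector_Spaces.linear_iff
      using vector_space_axioms by (auto intro: exI [of _ 0])
    have ne: "span B \<noteq> {}" using span_zero by blast
    have pos: "0 < infdist b (span B)"
      using False insert ne by (simp add: infdist_pos_not_in_closed)
    obtain g c where g: "Vector_Spaces.linear scale (*) g" "bounded_linear g"
        "\<And>f. f \<in> span B \<Longrightarrow> g f = 0" "g (scale c b) = 1"
    proof (rule P.functional_separating [where b = b and F = "span B", OF z subspace_span pos])
      fix f assume "f \<in> span B"
      then show "infdist b (span B) \<le> norm (b - 0 - f)"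
        using infdist_le [of f "span B" b] by (simp add: dist_norm)
    qed (use that in blast)
    interpret g: bounded_linear g by (rule g)
    have cg: "c * g b = 1" using g(1,4) by (simp add: Vector_Spaces.linear_iff)
    have "span (insert b B) = {y. y - scale (g y) (scale c b) \<in> span B}"
    proof (rule set_eqI, unfold span_breakdown_eq mem_Collect_eq, rule iffI)
      fix y assume "\<exists>k. y - scale k b \<in> span B"
      then obtain k where k: "y - scale k b \<in> span B" by blast
      have "g y = k * g b"
        using g(1) g(3) [OF k] by (simp add: g.diff Vector_Spaces.linear_iff)
      then have "g y * c = k" using cg by (simp add: mult.assoc mult.commute)
      then show "y - scale (g y) (scale c b) \<in> span B" using k by simp
    qed auto
    moreover have "closed {y. y - scale (g y) (scale c b) \<in> span B}"
    proof -
      have "bounded_linear (\<lambda>k. scale k (scale c b))"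
      proof (rule bounded_linear_intro)
        show "scale (r *\<^sub>R k) (scale c b) = r *\<^sub>R scale k (scale c b)" for r k
          by (metis scale_of_real scale_scale scaleR_conv_of_real)
        show "norm (scale k (scale c b)) \<le> norm k * norm (scale c b)" for k
          by (simp only: norm_scale)
      qed (rule scale_left_distrib)
      then have "bounded_linear (\<lambda>y. scale (g y) (scale c b))"
        using g(2) by (rule bounded_linear_compose)
      then have "continuous_on UNIV (\<lambda>y. y - scale (g y) (scale c b))"
        by (intro continuous_on_diff continuous_on_id linear_continuous_on)
      then show ?thesis
        using closed_vimage [OF insert.IH] by (simp add: vimage_def)
    qed
    ultimately show ?thesis by simp
  qed
qed simp

context banach_pair
begin

text \<open>
  If the functional did not exist, then the vectors of norm \<open>\<delta>\<close> would be approximated within \<open>\<delta> / 2\<close> by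
  \<open>S x + f\<close> with \<open>\<parallel>x\<parallel> \<le> 1\<close> and \<open>f\<close> in the span of \<open>B\<close>. Successive approximation would make \<open>S\<close> onto
  modulo this span.
\<close>

lemma not_finite_codim_imp_functional:
  assumes S: "S \<in> bounded_ops sX sY" and inf: "\<not> finite_codim sY (range S)"
    and B: "finite B" and \<delta>: "0 < \<delta>"
  obtains g w where "Vector_Spaces.linear sY (*) g" "bounded_linear g"
    "\<And>f. f \<in> B \<Longrightarrow> g f = 0" "\<And>x. norm (g (S x)) \<le> norm x" "g w = 1" "norm w \<le> \<delta>"
proof -
  have bl: "bounded_linear S" using S by (rule bounded_ops_imp_bounded_linear)
  have "\<exists>b. norm b = \<delta> \<and> (\<forall>x f. f \<in> Y.span B \<longrightarrow> norm x \<le> 1 \<longrightarrow> \<delta> / 2 < norm (b - S x - f))"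
  proof (rule ccontr)
    assume "\<not> ?thesis"
    then have approx: "\<exists>x f. f \<in> Y.span B \<and> norm x \<le> 1 \<and> norm (y - S x - f) \<le> \<delta> / 2"
      if "norm y = \<delta>" for y using that by (fastforce simp: not_less)
    obtain C where "0 \<le> C" and C: "\<And>y. \<exists>x. y - S x \<in> Y.span B \<and> norm x \<le> C * norm y"
      using solvable_of_approximately_open [OF bl Y.real_subspace [OF Y.subspace_span]
          Y.closed_span_finite [OF B] \<delta> zero_le_one approx] by blast
    have "\<exists>b\<in>Y.span B. y - b \<in> range S" for y
    proof -
      obtain x where "y - S x \<in> Y.span B" using C by blast
      then show ?thesis by (intro bexI [of _ "y - S x"]) auto
    qed
    then have "finite_codim sY (range S)"
      using B finite_codim_iff [OF Y.module_axioms subspace_range [OF S]] by blast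
    with inf show False ..
  qed
  then obtain b where b: "norm b = \<delta>"
      "\<And>x f. norm x \<le> 1 \<Longrightarrow> f \<in> Y.span B \<Longrightarrow> \<delta> / 2 \<le> norm (b - S x - f)"
    by (metis less_imp_le)
  obtain g c where g: "Vector_Spaces.linear sY (*) g" "bounded_linear g" "\<And>f. f \<in> Y.span B \<Longrightarrow> g f = 0"
    "\<And>x. norm (g (S x)) \<le> norm x" "g (sY c b) = 1" "norm c \<le> 1"
    using functional_separating [OF S Y.subspace_span half_gt_zero [OF \<delta>] b(2)] by blast
  have "norm (sY c b) \<le> \<delta>"
    using g(6) b(1) \<delta> by (simp add: Y.norm_scale)
  then show ?thesis using g Y.span_base by (intro that [of g "sY c b"]) auto
qed

end

context banach_pair
begin

section \<open>A quotient of infinite dimension on which an operator is small\<close>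

text \<open>
  The next functional is chosen to vanish at the earlier \<open>w m\<close>, and the next vector has to lie in the
  kernels of the earlier functionals. The projection \<open>v \<mapsto> v - (\<Sum>m<n. g m v * w m)\<close> onto the
  intersection of these kernels is known before the choice and does not change
  the value of the new functional; so it suffices to choose a vector that is small in
  comparison with a bound \<open>D\<close> for the norm of this projection.
\<close>

lemma biorthogonal_sequence:
  assumes S: "S \<in> bounded_ops sX sY" and inf: "\<not> finite_codim sY (range S)"
    and B: "finite B" and \<eta>: "\<And>n :: nat. 0 < \<eta> n"
  obtains g :: "nat \<Rightarrow> 'b \<Rightarrow> 'k" and w :: "nat \<Rightarrow> 'b" where
    "\<And>n. Vector_Spaces.linear sY (*) (g n)" "\<And>n. bounded_linear (g n)"
    "\<And>n b. b \<in> B \<Longrightarrow> g n b = 0" "\<And>m n. g m (w n) = (if m = n then 1 else 0)"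
    "\<And>n x. norm (sY (g n (S x)) (w n)) \<le> \<eta> n * norm x"
proof -
  define P :: "(nat \<Rightarrow> ('b \<Rightarrow> 'k) \<times> 'b) \<Rightarrow> nat \<Rightarrow> ('b \<Rightarrow> 'k) \<times> 'b \<Rightarrow> bool" where
    "P h n z \<longleftrightarrow> (case z of (g, w) \<Rightarrow>
      Vector_Spaces.linear sY (*) g \<and> bounded_linear g \<and> (\<forall>b\<in>B. g b = 0) \<and>
      (\<forall>m<n. g (snd (h m)) = 0 \<and> fst (h m) w = 0) \<and> g w = 1 \<and>
      (\<forall>x. norm (g (S x)) * norm w \<le> \<eta> n * norm x))" for h n z
  \<comment> \<open>\<open>P h n z\<close>: the pair \<open>z\<close> is an admissible choice at stage \<open>n\<close> after the choices \<open>h\<close> made before.\<close>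
  have "\<exists>h. \<forall>n. P h n (h n)"
  proof (rule dependent_wellorder_choice)
    fix r :: "('b \<Rightarrow> 'k) \<times> 'b" and h h' :: "nat \<Rightarrow> ('b \<Rightarrow> 'k) \<times> 'b" and n
    assume "\<And>m. m < n \<Longrightarrow> h m = h' m"
    then show "P h n r = P h' n r" by (auto simp: P_def)
  next
    fix n :: nat and h :: "nat \<Rightarrow> ('b \<Rightarrow> 'k) \<times> 'b"
    assume IH: "\<And>m. m < n \<Longrightarrow> P h m (h m)"
    define g where "g m = fst (h m)" for m
    define w where "w m = snd (h m)" for m
    have IH': "Vector_Spaces.linear sY (*) (g m)" "bounded_linear (g m)"
        "\<And>i. i < m \<Longrightarrow> g m (w i) = 0" "\<And>i. i < m \<Longrightarrow> g i (w m) = 0" "g m (w m) = 1" if "m < n" for m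
      using IH [OF that] by (auto simp: P_def g_def w_def split: prod.splits)
    have bi: "g i (w j) = (if i = j then 1 else 0)" if "i < n" "j < n" for i j
      using that IH'(3-5) by (cases i j rule: linorder_cases) simp_all
    define D where "D = 1 + (\<Sum>m<n. onorm (g m) * norm (w m))"
    have D: "0 < D"
    proof -
      have "0 \<le> (\<Sum>m<n. onorm (g m) * norm (w m))"
        using IH'(2) by (intro sum_nonneg mult_nonneg_nonneg onorm_pos_le) auto
      then show ?thesis by (simp add: D_def)
    qed
    have fin: "finite (B \<union> w ` {..<n})" using B by simp
    have pos: "0 < \<eta> n / D" using \<eta> D by simp
    obtain g' w' where g': "Vector_Spaces.linear sY (*) g'" "bounded_linear g'"
        "\<And>f. f \<in> B \<union> w ` {..<n} \<Longrightarrow> g' f = 0" "\<And>x. norm (g' (S x)) \<le> norm x"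
        "g' w' = 1" "norm w' \<le> \<eta> n / D"
      using not_finite_codim_imp_functional [OF S inf fin pos] by blast
    define v where "v = w' - (\<Sum>m<n. sY (g m w') (w m))"
    have "norm v \<le> norm w' + norm (\<Sum>m<n. sY (g m w') (w m))"
      unfolding v_def by (rule norm_triangle_ineq4)
    also have "norm (\<Sum>m<n. sY (g m w') (w m)) \<le> (\<Sum>m<n. norm (sY (g m w') (w m)))"
      by (rule norm_sum)
    also have "\<dots> \<le> (\<Sum>m<n. (onorm (g m) * norm w') * norm (w m))"
      unfolding Y.norm_scale using IH'(2) by (intro sum_mono mult_right_mono onorm) auto
    finally have "norm v \<le> norm w' + (\<Sum>m<n. onorm (g m) * norm w' * norm (w m))" by simp
    also have "\<dots> = D * norm w'"
      by (simp add: D_def distrib_left sum_distrib_left mult_ac)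
    also have "\<dots> \<le> \<eta> n" using g'(6) D by (simp add: field_simps)
    finally have v: "norm v \<le> \<eta> n" .
    have lin': "g' (x - y) = g' x - g' y" "g' (sum f A) = (\<Sum>a\<in>A. g' (f a))" "g' (sY c x) = c * g' x"
      for x y c A and f :: "nat \<Rightarrow> 'b"
      using g'(1,2) by (auto simp: bounded_linear.linear linear_diff linear_sum Vector_Spaces.linear_iff)
    have lin: "g m (x - y) = g m x - g m y" "g m (sum f A) = (\<Sum>a\<in>A. g m (f a))"
        "g m (sY c x) = c * g m x" if "m < n" for m x y c A and f :: "nat \<Rightarrow> 'b"
      using IH'(1,2) [OF that]
      by (auto simp: bounded_linear.linear linear_diff linear_sum Vector_Spaces.linear_iff)
    have "g' v = 1" by (simp add: v_def lin' g'(3,5))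
    moreover have "g m v = 0" if m: "m < n" for m
    proof -
      have "(\<Sum>i<n. g i w' * g m (w i)) = (\<Sum>i<n. if i = m then g m w' else 0)"
        using m by (intro sum.cong) (auto simp: bi)
      then show ?thesis using m by (simp add: v_def lin [OF m])
    qed
    moreover have "norm (g' (S x)) * norm v \<le> \<eta> n * norm x" for x
      using mult_mono [OF g'(4) v, of x] by (simp add: mult.commute)
    ultimately have "P h n (g', v)"
      using g' by (auto simp: P_def g_def w_def)
    then show "\<exists>r. P h n r" ..
  qed
  then obtain h where h: "\<And>n. P h n (h n)" by blast
  define g where "g m = fst (h m)" for m
  define w where "w m = snd (h m)" for m
  have gw: "Vector_Spaces.linear sY (*) (g m)" "bounded_linear (g m)" "\<And>b. b \<in> B \<Longrightarrow> g m b = 0"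
      "\<And>i. i < m \<Longrightarrow> g m (w i) = 0" "\<And>i. i < m \<Longrightarrow> g i (w m) = 0" "g m (w m) = 1"
      "\<And>x. norm (g m (S x)) * norm (w m) \<le> \<eta> m * norm x" for m
    using h [of m] by (auto simp: P_def g_def w_def split: prod.splits)
  have "g m (w n) = (if m = n then 1 else 0)" for m n
    by (cases m n rule: linorder_cases) (simp_all add: gw(4-6))
  then show ?thesis using gw by (intro that [of g w]) (simp_all add: Y.norm_scale)
qed

text \<open>
  The series \<open>A = (\<Sum>n. g n (S x) * w n)\<close> has norm at most \<open>\<epsilon> * \<parallel>x\<parallel>\<close>, and by biorthogonality \<open>S x - A\<close>
  lies in the common kernel \<open>N\<close> of the functionals. If \<open>N\<close> had finite codimension, then modulo
  \<open>N\<close> the vectors \<open>w n\<close> would be represented in a finite-dimensional space, where their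
  representatives are linearly independent because they are biorthogonal to the functionals.
\<close>

lemma not_finite_codim_imp_small_quotient:
  assumes S: "S \<in> bounded_ops sX sY" and inf: "\<not> finite_codim sY (range S)"
    and B: "finite B" and \<epsilon>: "0 < \<epsilon>"
  obtains N where "closed_subspace sY N" "\<not> finite_codim sY N" "B \<subseteq> N"
    "\<And>x. \<exists>z\<in>N. norm (S x - z) \<le> \<epsilon> * norm x"
proof -
  obtain g w where g: "\<And>n. Vector_Spaces.linear sY (*) (g n)" "\<And>n. bounded_linear (g n)"
    and gB: "\<And>n b. b \<in> B \<Longrightarrow> g n b = 0"
    and bi: "\<And>m n. g m (w n) = (if m = n then 1 else 0)"
    and small: "\<And>n x. norm (sY (g n (S x)) (w n)) \<le> (\<epsilon> * (1 / 2) ^ Suc n) * norm x"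
    using biorthogonal_sequence [OF S inf B, of "\<lambda>n. \<epsilon> * (1 / 2) ^ Suc n"] \<epsilon> by auto
  have lin: "g n (x + y) = g n x + g n y" "g n (x - y) = g n x - g n y" "g n (sY c x) = c * g n x"
      "g n 0 = 0" for n x y c
    using g [of n] by (auto simp: bounded_linear.linear linear_diff linear_0 Vector_Spaces.linear_iff)
  define N where "N = {y. \<forall>n. g n y = 0}"
  have sub: "Y.subspace N" by (auto simp: Y.subspace_def N_def lin)
  moreover have "closed N"
  proof -
    have "N = (\<Inter>n. {y. g n y = 0})" by (auto simp: N_def)
    moreover have "closed {y. g n y = 0}" for n
      by (intro closed_Collect_eq linear_continuous_on g continuous_on_const)
    ultimately show ?thesis by auto
  qed
  ultimately have "closed_subspace sY N" by (simp add: closed_subspace_def)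
  moreover have "\<not> finite_codim sY N"
  proof
    assume "finite_codim sY N"
    then obtain A where A: "finite A" "\<And>y. \<exists>b\<in>Y.span A. y - b \<in> N"
      using finite_codim_iff [OF Y.module_axioms sub] by blast
    then have "\<forall>n. \<exists>b. b \<in> Y.span A \<and> w n - b \<in> N" by blast
    then obtain b where b: "\<And>n. b n \<in> Y.span A" "\<And>n. w n - b n \<in> N" by metis
    have gb: "g m (b n) = (if m = n then 1 else 0)" for m n
      using b(2) [of n] bi [of m n] by (auto simp: N_def lin)
    have inj: "inj b" by (rule injI) (metis gb zero_neq_one)
    have "Y.independent (range b)"
    proof
      assume "Y.dependent (range b)"
      then obtain m where m: "b m \<in> Y.span (range b - {b m})"
        unfolding Y.dependent_def by blast
      have "Y.span (range b - {b m}) \<subseteq> {y. g m y = 0}"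
        by (rule Y.span_minimal) (auto simp: Y.subspace_def lin gb)
      then show False using m gb [of m m] by auto
    qed
    then have "finite (range b)"
      using Y.independent_span_bound [OF A(1)] b(1) by blast
    then show False using inj finite_imageD by blast
  qed
  moreover have "B \<subseteq> N" using gB by (auto simp: N_def)
  moreover have "\<exists>z\<in>N. norm (S x - z) \<le> \<epsilon> * norm x" for x
  proof -
    let ?a = "\<lambda>n. sY (g n (S x)) (w n)"
    have geo: "(\<lambda>n. (\<epsilon> * (1 / 2) ^ Suc n) * norm x) sums ((\<epsilon> * 1) * norm x)"
      by (intro sums_mult sums_mult2 power_half_series)
    have sumn: "summable (\<lambda>n. norm (?a n))"
      by (rule summable_comparison_test' [OF sums_summable [OF geo], of 0])
        (simp only: small real_norm_def abs_norm_cancel)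
    define A where "A = (\<Sum>n. ?a n)"
    have A: "?a sums A" unfolding A_def using summable_norm_cancel [OF sumn] by (rule summable_sums)
    have "norm A \<le> (\<Sum>n. norm (?a n))" unfolding A_def by (rule summable_norm [OF sumn])
    also have "\<dots> \<le> \<epsilon> * norm x"
      using suminf_le [OF small sumn sums_summable [OF geo]] sums_unique [OF geo] by simp
    finally have "norm A \<le> \<epsilon> * norm x" .
    moreover have "g m A = g m (S x)" for m
    proof -
      have "(\<lambda>n. g m (?a n)) sums g m A"
        by (rule bounded_linear.sums [OF g(2) A])
      moreover have "(\<lambda>n. g m (?a n)) = (\<lambda>n. if n = m then g m (S x) else 0)"
        by (auto simp: lin bi)
      ultimately show ?thesis
        using sums_single [of m "\<lambda>_. g m (S x)"] by (metis sums_unique2)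
    qed
    then have "S x - A \<in> N" by (simp add: N_def lin)
    ultimately show ?thesis by (intro bexI [of _ "S x - A"]) auto
  qed
  ultimately show ?thesis by (rule that)
qed

section \<open>Strictly cosingular operators are perturbations\<close>

lemma bounded_ops_add:
  assumes "S \<in> bounded_ops sX sY" "T \<in> bounded_ops sX sY"
  shows "(\<lambda>x. S x + T x) \<in> bounded_ops sX sY"
proof -
  obtain B C where BC: "\<And>x. norm (S x) \<le> B * norm x" "\<And>x. norm (T x) \<le> C * norm x"
    using assms by (auto simp: bounded_ops_def)
  have "norm (S x + T x) \<le> (B + C) * norm x" for x
    using norm_triangle_ineq [of "S x" "T x"] BC [of x] by (simp add: distrib_right)
  moreover have "Vector_Spaces.linear sX sY (\<lambda>x. S x + T x)"
    using assms by (auto simp: bounded_ops_def Vector_Spaces.linear_iff Y.scale_right_distrib algebra_simps)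
  ultimately show ?thesis by (auto simp: bounded_ops_def)
qed

lemma strictly_cosingular_imp_perturbation:
  assumes K: "K \<in> strictly_cosingular sX sY" and T: "T \<in> lower_semi_Fredholm sX sY"
  shows "(\<lambda>x. T x + K x) \<in> lower_semi_Fredholm sX sY"
proof (rule ccontr)
  let ?S = "\<lambda>x. T x + K x"
  assume notin: "?S \<notin> lower_semi_Fredholm sX sY"
  have Kb: "K \<in> bounded_ops sX sY" and Tb: "T \<in> bounded_ops sX sY"
    using K T by (auto simp: strictly_cosingular_def lower_semi_Fredholm_def)
  have Sb: "?S \<in> bounded_ops sX sY" by (rule bounded_ops_add [OF Tb Kb])
  have inf: "\<not> finite_codim sY (range ?S)"
    using notin Sb by (simp add: lower_semi_Fredholm_def)
  obtain B where B: "finite B" "\<And>y. \<exists>b\<in>Y.span B. y - b \<in> range T"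
    using T finite_codim_iff [OF Y.module_axioms subspace_range [OF Tb]]
    by (auto simp: lower_semi_Fredholm_def)
  have "\<exists>x. y - T x \<in> Y.span B" for y
  proof -
    obtain b x where "b \<in> Y.span B" "y - b = T x" using B(2) by blast
    then show ?thesis by (intro exI [of _ x]) (simp add: algebra_simps flip: \<open>y - b = T x\<close>)
  qed
  then obtain C where C: "0 \<le> C" "\<And>y. \<exists>x. y - T x \<in> Y.span B \<and> norm x \<le> C * norm y"
    using open_mapping_modulo [OF bounded_ops_imp_bounded_linear [OF Tb]
        Y.real_subspace [OF Y.subspace_span] Y.closed_span_finite [OF B(1)]] by blast
  \<comment> \<open>With this bound for \<open>T + K\<close> modulo \<open>N\<close>, the vector \<open>- x\<close> solves \<open>K x' = y\<close> modulo \<open>N\<close>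
    up to an error of at most half the norm of \<open>y\<close>.\<close>
  have "0 < 1 / (2 * (C + 1))" using C by simp
  then obtain N where N: "closed_subspace sY N" "\<not> finite_codim sY N" "B \<subseteq> N"
      and near: "\<And>x. \<exists>z\<in>N. norm (?S x - z) \<le> 1 / (2 * (C + 1)) * norm x"
    using not_finite_codim_imp_small_quotient [OF Sb inf B(1)] by blast
  have N_sub: "Y.subspace N" and N_closed: "closed N" using N by (auto simp: closed_subspace_def)
  have BN: "Y.span B \<subseteq> N" using N(3) N_sub by (rule Y.span_minimal)
  have approx: "\<exists>x f. f \<in> N \<and> norm x \<le> C * norm y \<and> norm (y - K x - f) \<le> 1 / 2 * norm y" for y
  proof -
    obtain x where x: "y - T x \<in> Y.span B" "norm x \<le> C * norm y" using C by blast
    obtain z where z: "z \<in> N" "norm (?S x - z) \<le> 1 / (2 * (C + 1)) * norm x" using near by blast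
    have "norm (?S x - z) \<le> 1 / (2 * (C + 1)) * (C * norm y)"
      using z(2) mult_left_mono [OF x(2), of "1 / (2 * (C + 1))"] C(1) by simp
    also have "\<dots> \<le> 1 / 2 * norm y"
      using C(1) by (simp add: field_simps)
    finally have "norm (?S x - z) \<le> 1 / 2 * norm y" .
    moreover have "y - K (- x) - (y - T x + z) = ?S x - z"
      using Kb by (simp add: linear_neg bounded_linear.linear bounded_ops_imp_bounded_linear)
    ultimately have "norm (y - K (- x) - (y - T x + z)) \<le> 1 / 2 * norm y"
      by (simp only:)
    moreover have "y - T x + z \<in> N"
      using x(1) z(1) BN N_sub by (blast intro: Y.subspace_add)
    ultimately show ?thesis
      using x(2) by (intro exI [of _ "- x"] exI [of _ "y - T x + z"]) auto
  qed
  have "\<exists>x. y - K x \<in> N" for y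
    using approximately_solvable_imp_solvable [OF bounded_ops_imp_bounded_linear [OF Kb]
        Y.real_subspace [OF N_sub] N_closed C(1) _ _ approx, of y] by auto
  then have "range (quot_map N \<circ> K) = quot N"
    by (simp only: range_quot_map_comp_eq_quot_iff [OF Y.module_axioms N_sub] simp_thms)
  then show False using K N by (auto simp: strictly_cosingular_def)
qed

end

section \<open>Perturbations are strictly cosingular\<close>

lemma bounded_ops_compose:
  assumes "A \<in> bounded_ops s2 s3" "B \<in> bounded_ops s1 s2"
  shows "(\<lambda>x. A (B x)) \<in> bounded_ops s1 s3"
proof -
  obtain a b where ab: "\<And>x. norm (A x) \<le> a * norm x" "\<And>x. norm (B x) \<le> b * norm x"
    using assms by (auto simp: bounded_ops_def)
  have "norm (A (B x)) \<le> (\<bar>a\<bar> * b) * norm x" for x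
  proof -
    have "norm (A (B x)) \<le> \<bar>a\<bar> * norm (B x)"
      using ab(1) [of "B x"] by (meson abs_ge_self mult_right_mono norm_ge_zero order_trans)
    also have "\<dots> \<le> \<bar>a\<bar> * (b * norm x)" using ab(2) by (intro mult_left_mono) auto
    finally show ?thesis by (simp add: mult.assoc)
  qed
  moreover have "Vector_Spaces.linear s1 s3 (\<lambda>x. A (B x))"
    using assms by (auto simp: bounded_ops_def Vector_Spaces.linear_iff)
  ultimately show ?thesis by (auto simp: bounded_ops_def)
qed

text \<open>
  If \<open>C\<close> is a bound for \<open>V\<close> and \<open>l = C + 1\<close>, then \<open>V x - l x = y\<close> is the fixed point equation of the
  contraction \<open>x \<mapsto> (V x - y) / l\<close>, and \<open>\<parallel>x\<parallel> \<le> \<parallel>V x - l x\<parallel>\<close> bounds the inverse.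
\<close>

lemma (in banach_over) bounded_ops_minus_scaleR_invertible:
  assumes V: "V \<in> bounded_ops scale scale"
  obtains l W' where "(\<lambda>x. V x - l *\<^sub>R x) \<in> bounded_ops scale scale" "W' \<in> bounded_ops scale scale" "l \<noteq> 0"
    "\<And>x. W' (V x - l *\<^sub>R x) = x" "\<And>y. V (W' y) - l *\<^sub>R W' y = y"
proof -
  obtain B where B: "\<And>x. norm (V x) \<le> B * norm x" using V by (auto simp: bounded_ops_def)
  define C where "C = max B 0"
  have C: "0 \<le> C" "norm (V x) \<le> C * norm x" for x
    using B [of x] mult_right_mono [of B C "norm x"] by (auto simp: C_def)
  define l where "l = C + 1"
  have l: "0 < l" using C by (simp add: l_def)
  define W where "W x = V x - l *\<^sub>R x" for x
  have V_lin: "V (x + y) = V x + V y" "V (scale c x) = scale c (V x)" for x y c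
    using V by (auto simp: bounded_ops_def Vector_Spaces.linear_iff)
  have V_diff: "V (x - y) = V x - V y" for x y
    using V_lin(1) [of "x - y" y] by simp
  have W_lin: "W (x + y) = W x + W y" "W (scale c x) = scale c (W x)" "W (x - y) = W x - W y" for x y c
    by (simp_all add: W_def V_lin V_diff algebra_simps scale_right_diff_distrib
        flip: scale_of_real)
  have below: "norm x \<le> norm (W x)" for x
  proof -
    have "norm (l *\<^sub>R x) \<le> norm (V x) + norm (W x)"
      using norm_triangle_ineq4 [of "V x" "W x"] by (simp add: W_def)
    then show ?thesis using C(2) [of x] l by (simp add: l_def distrib_right)
  qed
  have inj: "inj W"
  proof (rule injI)
    fix x y assume "W x = W y"
    then have "norm (x - y) \<le> 0" using below [of "x - y"] by (simp add: W_lin)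
    then show "x = y" by simp
  qed
  have "surj W"
  proof (rule surjI)
    fix y
    have "\<exists>!x. (1 / l) *\<^sub>R (V x - y) = x"
    proof (rule banach_fix_type)
      show "0 \<le> C / l" "C / l < 1" using C l by (auto simp: l_def)
      show "\<forall>x z. dist ((1 / l) *\<^sub>R (V x - y)) ((1 / l) *\<^sub>R (V z - y)) \<le> C / l * dist x z"
      proof (intro allI)
        fix x z
        have "(1 / l) *\<^sub>R (V x - y) - (1 / l) *\<^sub>R (V z - y) = (1 / l) *\<^sub>R V (x - z)"
          by (simp add: V_diff algebra_simps)
        then show "dist ((1 / l) *\<^sub>R (V x - y)) ((1 / l) *\<^sub>R (V z - y)) \<le> C / l * dist x z"
          using C(2) [of "x - z"] l by (simp add: dist_norm divide_right_mono)
      qed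
    qed
    then obtain x where "(1 / l) *\<^sub>R (V x - y) = x" by blast
    then have "l *\<^sub>R x = l *\<^sub>R (1 / l) *\<^sub>R (V x - y)" by simp
    also have "\<dots> = V x - y" using l by simp
    finally have "l *\<^sub>R x = V x - y" .
    then have "W x = y" by (simp add: W_def)
    then show "W (inv W y) = y" by (metis f_inv_into_f rangeI)
  qed
  then have WW: "W (inv W y) = y" for y by (simp add: surj_f_inv_f)
  have "inv W \<in> bounded_ops scale scale"
  proof -
    have "inv W (x + y) = inv W x + inv W y" for x y
      by (rule injD [OF inj]) (simp add: WW W_lin)
    moreover have "inv W (scale c x) = scale c (inv W x)" for c x
      by (rule injD [OF inj]) (simp add: WW W_lin)
    moreover have "norm (inv W y) \<le> 1 * norm y" for y
      using below [of "inv W y"] by (simp add: WW)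
    ultimately show ?thesis
      unfolding bounded_ops_def Vector_Spaces.linear_iff using vector_space_axioms by blast
  qed
  moreover have "W \<in> bounded_ops scale scale"
  proof -
    have "norm (W x) \<le> (C + l) * norm x" for x
      using norm_triangle_ineq4 [of "V x" "l *\<^sub>R x"] C(2) [of x] l by (simp add: W_def distrib_right)
    then show ?thesis
      unfolding bounded_ops_def Vector_Spaces.linear_iff using vector_space_axioms W_lin by blast
  qed
  ultimately show ?thesis
    using l WW inv_f_f [OF inj] by (intro that [of l "inv W"]) (simp_all add: W_def [abs_def])
qed

context banach_pair
begin

text \<open>
  \<open>T + K W = (T W' + K) W\<close>, and composition on the right with an invertible operator preserves ranges.
\<close>

lemma perturbation_compose_invertible:
  assumes K: "K \<in> perturbation_class_lower sX sY" and T: "T \<in> lower_semi_Fredholm sX sY"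
    and W: "W \<in> bounded_ops sX sX" "W' \<in> bounded_ops sX sX"
    and inverse: "\<And>x. W' (W x) = x" "\<And>x. W (W' x) = x"
  shows "(\<lambda>x. T x + K (W x)) \<in> lower_semi_Fredholm sX sY"
proof -
  have "range (\<lambda>x. T (W' x)) = range T"
    using inverse(1) by (auto simp: image_iff) metis
  moreover have "T \<in> bounded_ops sX sY" using T by (simp add: lower_semi_Fredholm_def)
  ultimately have "(\<lambda>x. T (W' x)) \<in> lower_semi_Fredholm sX sY"
    using T bounded_ops_compose [OF _ W(2)] by (simp add: lower_semi_Fredholm_def)
  then have R: "(\<lambda>x. T (W' x) + K x) \<in> lower_semi_Fredholm sX sY"
    using K by (auto simp: perturbation_class_lower_def)
  have "range (\<lambda>x. T x + K (W x)) = range (\<lambda>x. T (W' x) + K x)"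
    using inverse by (auto simp: image_iff) metis+
  moreover have "(\<lambda>x. T (W' (W x)) + K (W x)) \<in> bounded_ops sX sY"
    using R by (intro bounded_ops_compose [OF _ W(1)]) (simp add: lower_semi_Fredholm_def)
  ultimately show ?thesis using R by (simp add: lower_semi_Fredholm_def inverse)
qed

text \<open>
  \<open>V\<close> is the sum of the invertible operators \<open>V - l\<close> and \<open>l\<close>, which are added one after the other.
\<close>

lemma perturbation_compose:
  assumes K: "K \<in> perturbation_class_lower sX sY" and T: "T \<in> lower_semi_Fredholm sX sY"
    and V: "V \<in> bounded_ops sX sX"
  shows "(\<lambda>x. T x + K (V x)) \<in> lower_semi_Fredholm sX sY"
proof -
  obtain l W' where W: "(\<lambda>x. V x - l *\<^sub>R x) \<in> bounded_ops sX sX" "W' \<in> bounded_ops sX sX" "l \<noteq> 0"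
      "\<And>x. W' (V x - l *\<^sub>R x) = x" "\<And>y. V (W' y) - l *\<^sub>R W' y = y"
    using X.bounded_ops_minus_scaleR_invertible [OF V] by blast
  have "r *\<^sub>R sX c x = sX c (r *\<^sub>R x)" for r c x
    by (metis X.scale_of_real X.scale_left_commute)
  then have scaleR: "(\<lambda>x. r *\<^sub>R x) \<in> bounded_ops sX sX" for r
    unfolding bounded_ops_def Vector_Spaces.linear_iff
    using X.vector_space_axioms by (auto simp: scaleR_right_distrib intro: exI [of _ "\<bar>r\<bar>"])
  have "(\<lambda>x. T x + K (V x - l *\<^sub>R x)) \<in> lower_semi_Fredholm sX sY"
    by (rule perturbation_compose_invertible [OF K T W(1,2,4,5)])
  then have "(\<lambda>x. (T x + K (V x - l *\<^sub>R x)) + K (l *\<^sub>R x)) \<in> lower_semi_Fredholm sX sY"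
    by (rule perturbation_compose_invertible [OF K _ scaleR scaleR [of "1 / l"]]) (use W(3) in auto)
  moreover have "K x - K y = K (x - y)" for x y
    using K by (simp add: perturbation_class_lower_def bounded_ops_imp_bounded_linear bounded_linear.linear linear_diff)
  then have "(T x + K (V x - l *\<^sub>R x)) + K (l *\<^sub>R x) = T x + K (V x)" for x
    by (metis (no_types) add.assoc diff_add_cancel)
  ultimately show ?thesis by simp
qed

lemma isomorphic_quot_imp_operator_onto:
  assumes M: "closed_subspace sX M" and iso: "isomorphic_quot sX sY M N"
  obtains A where "A \<in> bounded_ops sX sY" "range A = N"
proof -
  have M_sub: "X.subspace M" using M by (simp add: closed_subspace_def)
  obtain \<phi> B where bij: "bij_betw \<phi> (quot M) N"
    and add: "\<And>C D. C \<in> quot M \<Longrightarrow> D \<in> quot M \<Longrightarrow> \<phi> (quot_add C D) = \<phi> C + \<phi> D"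
    and scale: "\<And>c C. C \<in> quot M \<Longrightarrow> \<phi> (quot_scale sX M c C) = sY c (\<phi> C)"
    and B: "\<And>C. C \<in> quot M \<Longrightarrow> norm (\<phi> C) \<le> B * quot_norm C"
    using iso unfolding isomorphic_quot_def by blast
  define A where "A x = \<phi> (quot_map M x)" for x
  have q: "quot_map M x \<in> quot M" for x by (simp add: quot_def)
  have "A (x + y) = A x + A y" for x y
    by (simp add: A_def q flip: add quot_add_quot_map [OF X.module_axioms M_sub])
  moreover have "A (sX c x) = sY c (A x)" for c x
    by (simp add: A_def q flip: scale quot_scale_quot_map [OF X.module_axioms M_sub])
  moreover have "norm (A x) \<le> \<bar>B\<bar> * norm x" for x
  proof -
    have x: "x \<in> quot_map M x"
      using X.subspace_0 [OF M_sub] by (auto simp: quot_map_def intro: exI [of _ 0])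
    have bdd: "bdd_below (norm ` quot_map M x)" by (rule bdd_belowI [of _ 0]) auto
    have "quot_norm (quot_map M x) \<le> norm x"
      unfolding quot_norm_def by (rule cINF_lower [OF bdd x])
    moreover have "0 \<le> quot_norm (quot_map M x)"
      unfolding quot_norm_def using x by (intro cINF_greatest) auto
    ultimately have "B * quot_norm (quot_map M x) \<le> \<bar>B\<bar> * norm x"
      by (intro mult_mono) auto
    then show ?thesis using B [OF q] unfolding A_def by (rule order_trans [rotated])
  qed
  ultimately have "A \<in> bounded_ops sX sY"
    unfolding bounded_ops_def Vector_Spaces.linear_iff
    using X.vector_space_axioms Y.vector_space_axioms by blast
  moreover have "range A = N"
    using bij by (auto simp: A_def bij_betw_def quot_def image_image)
  ultimately show ?thesis by (rule that)
qed

lemma perturbation_imp_strictly_cosingular: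
  assumes K: "K \<in> perturbation_class_lower sX sY"
    and square: "\<exists>U \<in> bounded_ops_square sX. surj U"
    and quotients: "\<And>L. closed_subspace sY L \<Longrightarrow> \<not> finite_codim sY L \<Longrightarrow>
           \<exists>N. L \<subseteq> N \<and> closed_subspace sY N \<and> \<not> finite_codim sY N \<and>
               (\<exists>M. closed_subspace sX M \<and> isomorphic_quot sX sY M N)"
  shows "K \<in> strictly_cosingular sX sY"
proof (rule ccontr)
  assume notin: "K \<notin> strictly_cosingular sX sY"
  have Kb: "K \<in> bounded_ops sX sY" using K by (simp add: perturbation_class_lower_def)
  then obtain L where L: "closed_subspace sY L" "\<not> finite_codim sY L" "range (quot_map L \<circ> K) = quot L"
    using notin by (auto simp: strictly_cosingular_def)
  then have "Y.subspace L" by (simp add: closed_subspace_def)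
  with L(3) have KL: "\<exists>x. y - K x \<in> L" for y
    by (simp only: range_quot_map_comp_eq_quot_iff [OF Y.module_axioms])
  obtain N M where N: "L \<subseteq> N" "\<not> finite_codim sY N"
      and M: "closed_subspace sX M" "isomorphic_quot sX sY M N"
    using quotients [OF L(1,2)] by blast
  obtain A where A: "A \<in> bounded_ops sX sY" "range A = N"
    using isomorphic_quot_imp_operator_onto [OF M] by blast
  obtain U where U: "U \<in> bounded_ops_square sX" "surj U" using square by blast
  have U_lin: "U (x + y) = U x + U y" "U (sX c x) = map_prod (sX c) (sX c) (U x)" for x y c
    using U(1) by (auto simp: bounded_ops_square_def Vector_Spaces.linear_iff)
  obtain B where B: "\<And>x. max (norm (fst (U x))) (norm (snd (U x))) \<le> B * norm x"
    using U(1) by (auto simp: bounded_ops_square_def)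
  have fstU: "(\<lambda>x. fst (U x)) \<in> bounded_ops sX sX"
    and sndU: "(\<lambda>x. snd (U x)) \<in> bounded_ops sX sX"
    and minusU: "(\<lambda>x. - snd (U x)) \<in> bounded_ops sX sX"
    unfolding bounded_ops_def Vector_Spaces.linear_iff
    using X.vector_space_axioms B by (auto simp: U_lin intro!: exI [of _ B])
  define T where "T x = A (fst (U x)) + K (- snd (U x))" for x
  have "T \<in> bounded_ops sX sY"
    unfolding T_def
    by (intro bounded_ops_add bounded_ops_compose [OF A(1) fstU] bounded_ops_compose [OF Kb minusU])
  moreover have "range T = UNIV"
  proof -
    have "\<exists>x. y = T x" for y
    proof -
      obtain x where "y - K x \<in> N" using KL N(1) by blast
      then obtain z where z: "y - K x = A z" using A(2) by blast
      obtain u where "U u = (z, - x)" using U(2) by (metis surjD)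
      then have "T u = y" using z by (simp add: T_def flip: z)
      then show ?thesis by blast
    qed
    then show ?thesis by auto
  qed
  moreover have "finite_codim sY (UNIV :: 'b set)"
    using finite_codim_iff [OF Y.module_axioms Y.subspace_UNIV] Y.span_zero
    by (auto intro!: exI [of _ "{}"])
  ultimately have "T \<in> lower_semi_Fredholm sX sY" by (simp add: lower_semi_Fredholm_def)
  then have "(\<lambda>x. T x + K (snd (U x))) \<in> lower_semi_Fredholm sX sY"
    by (rule perturbation_compose [OF K _ sndU])
  moreover have "T x + K (snd (U x)) = A (fst (U x))" for x
    using Kb by (simp add: T_def linear_neg bounded_linear.linear bounded_ops_imp_bounded_linear)
  ultimately have "finite_codim sY (range (\<lambda>x. A (fst (U x))))"
    by (simp add: lower_semi_Fredholm_def)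
  moreover have "range (\<lambda>x. A (fst (U x))) = N"
  proof -
    have "\<exists>x. z = fst (U x)" for z
      using U(2) by (metis fst_conv surjD)
    then have "range (\<lambda>x. fst (U x)) = UNIV" by auto
    then show ?thesis using A(2) by (metis image_image)
  qed
  ultimately show False using N(2) by simp
qed

end

theorem theorem4p6:
  fixes sX :: "'k::real_normed_field \<Rightarrow> 'a::banach \<Rightarrow> 'a"
    and sY :: "'k \<Rightarrow> 'b::banach \<Rightarrow> 'b"
  assumes "banach_over sX" and "banach_over sY"
    and "lower_semi_Fredholm sX sY \<noteq> {}"
    and "\<exists>U \<in> bounded_ops_square sX. surj U"
    and "\<And>L. closed_subspace sY L \<Longrightarrow> \<not> finite_codim sY L \<Longrightarrow>
           \<exists>N. L \<subseteq> N \<and> closed_subspace sY N \<and> \<not> finite_codim sY N \<and>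
               (\<exists>M. closed_subspace sX M \<and> isomorphic_quot sX sY M N)"
  shows "perturbation_class_lower sX sY = strictly_cosingular sX sY"
proof -
  interpret banach_pair sX sY
    using assms(1,2) by (rule banach_pair.intro)
  show ?thesis
  proof (intro subset_antisym subsetI)
    fix K assume "K \<in> perturbation_class_lower sX sY"
    then show "K \<in> strictly_cosingular sX sY"
      using assms(4,5) by (rule perturbation_imp_strictly_cosingular)
  next
    fix K assume "K \<in> strictly_cosingular sX sY"
    then show "K \<in> perturbation_class_lower sX sY"
      using strictly_cosingular_imp_perturbation
      by (auto simp: perturbation_class_lower_def strictly_cosingular_def)
  qed
qed

end
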